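(* Let $\gamma_{\mathbf{k}}$, $\mathbf{k} \in \Lambda\setminus\{0\}$, be any sequence of complex numbers such that $\gamma_{-\mathbf{k}} = \bar{\gamma}_{\mathbf{k}}$, and set $\gamma=\{\gamma_{\mathbf{k}}\}_{\mathbf{k} \in \Lambda}$ where $\gamma_0=1$. Then, for $c \in \mathfrak{C}_+$, the convex optimization problem (D) to minimize $$\mathbb{J}(P,Q) = \langle c, q \rangle - \langle \gamma, p \rangle + \int_{\mathbb{T}^d} P \log \left(\frac{P}{Q}\right) dm$$ subject to $(P,Q) \in\bar{\mathfrak{P}}_{+,\circ}\times \bar{\mathfrak{P}}_+$ has an optimal solution $(\hat{P}, \hat{Q})$. If such a solution belongs to $\mathfrak{P}_{+, \circ} \times \mathfrak{P}_{+}$, then $\hat\Phi = \hat{P}/\hat{Q}$ satisfies the logarithmic moment condition $$\gamma_{\mathbf{k}}= \int_{\mathbb{T}^d} e^{i (\mathbf{k},\boldsymbol{\theta})} \log\hat\Phi(e^{i\boldsymbol{\theta}})\, dm (\boldsymbol{\theta})\quad\text{for } \mathbf{k}\in \Lambda\setminus \{0\},$$ and $d\mu=\hat\Phi\, dm$ satisfies the moment condition $$c_{\mathbf{k}}=\int_{\mathbb{T}^d}e^{i(\mathbf{k},\boldsymbol{\theta})}\,d\mu(\boldsymbol{\theta})\quad\text{for all }\mathbf{k}\in\Lambda.$$ Moreover, in that case $\hat\Phi$ is also an optimal solution to the problem (P) to maximize $$\mathbb{I}(\Phi) = \int_{\mathbb{T}^d} \log \Phi \, dm$$ subject to $\gamma_{\mathbf{k}}=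 \int_{\mathbb{T}^d} e^{i (\mathbf{k},\boldsymbol{\theta})} \log\Phi\, dm$ for $\mathbf{k}\in\Lambda\setminus\{0\}$ and $c_{\mathbf{k}}=\int_{\mathbb{T}^d}e^{i(\mathbf{k},\boldsymbol{\theta})}\Phi\,dm$ for $\mathbf{k}\in\Lambda$. Finally, if $d\leq 2$, then $\hat{P} \in \mathfrak{P}_{+, \circ}$ implies that $\hat{Q} \in \mathfrak{P}_{+}$.
   Context: Let $d\ge 1$, $\mathbb{T}=(-\pi,\pi]$, $\boldsymbol{\theta}=(\theta_1,\dots,\theta_d)$, $e^{i\boldsymbol{\theta}}=(e^{i\theta_1},\dots,e^{i\theta_d})$, $(\mathbf{k},\boldsymbol{\theta})=\sum_{j=1}^d k_j\theta_j$, and $dm(\boldsymbol{\theta})=(1/2\pi)^d\prod_{j=1}^d d\theta_j$. The index set $\Lambda\subset\mathbb{Z}^d$ is finite with $0\in\Lambda$ and $-\Lambda=\Lambda$. Trigonometric polynomials are $P(e^{i\boldsymbol{\theta}})=\sum_{\mathbf{k}\in\Lambda}p_{\mathbf{k}}e^{-i(\mathbf{k},\boldsymbol{\theta})}$ with $p_{-\mathbf{k}}=\bar p_{\mathbf{k}}$ (real valued), identified with their coefficient vector $p=(p_{\mathbf{k}})_{\mathbf{k}\in\Lambda}$ (similarly $Q\leftrightarrow q$). $\mathfrak{P}_+$ is the convex cone of such polynomials that are positive for all $\boldsymbol{\theta}\in\mathbb{T}^d$; $\bar{\mathfrak{P}}_+$ is its closure (nonnegative polynomials). $\mathfrak{P}_{+,\circ}=\{P\in\mathfrak{P}_+\mid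 p_0=1\}$, with closure $\bar{\mathfrak{P}}_{+,\circ}=\{P\in\bar{\mathfrak{P}}_+\mid p_0=1\}$. Sequences $c=(c_{\mathbf{k}})_{\mathbf{k}\in\Lambda}$ are complex with $c_{-\mathbf{k}}=\bar c_{\mathbf{k}}$; $\langle c,p\rangle=\sum_{\mathbf{k}\in\Lambda}c_{\mathbf{k}}\bar p_{\mathbf{k}}$, and likewise for $\langle\gamma,p\rangle$. $\mathfrak{C}_+=\{c\mid\langle c,p\rangle>0\text{ for all }P\in\bar{\mathfrak{P}}_+\setminus\{0\}\}$. The problem (P) is over nonnegative functions $\Phi\in L^1(\mathbb{T}^d)$. The value of $\mathbb{J}(P,Q)$ is $+\infty$ for $Q\equiv0$, and $0\log 0=0$. *)

theory Defs
  imports "HOL-Analysis.Analysis"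
begin

text \<open>The dimension \<open>d\<close> is \<open>CARD('d)\<close>; multi-indices have type \<open>int ^ 'd\<close> and angles
  have type \<open>real ^ 'd\<close>.\<close>

definition torus :: "(real ^ 'd) set" where
  "torus = {\<theta>. \<forall>j. - pi < \<theta> $ j \<and> \<theta> $ j \<le> pi}"

definition torus_measure :: "(real ^ 'd) measure" where
  "torus_measure = density (lebesgue_on torus) (\<lambda>_. ennreal ((1 / (2 * pi)) ^ CARD('d)))"

definition idx_inner :: "int ^ 'd \<Rightarrow> real ^ 'd \<Rightarrow> real" where
  "idx_inner k \<theta> = (\<Sum>j\<in>UNIV. of_int (k $ j) * \<theta> $ j)"

definition character :: "int ^ 'd \<Rightarrow> real ^ 'd \<Rightarrow> complex" where
  "character k \<theta> = exp (\<i> * complex_of_real (idx_inner k \<theta>))"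

text \<open>A family indexed by \<open>\<Lambda>\<close> is a function on all multi-indices that vanishes off \<open>\<Lambda>\<close>.\<close>

definition coeffs :: "(int ^ 'd) set \<Rightarrow> (int ^ 'd \<Rightarrow> complex) set" where
  "coeffs \<Lambda> = {p. (\<forall>k. k \<notin> \<Lambda> \<longrightarrow> p k = 0) \<and> (\<forall>k\<in>\<Lambda>. p (- k) = cnj (p k))}"

text \<open>The sums in the next two definitions are real for arguments in \<open>coeffs \<Lambda>\<close>
  (\<open>of_real_trig_poly\<close> and \<open>of_real_pairing\<close> below), so that taking real parts is only a
  change of type.\<close>

definition trig_poly :: "(int ^ 'd) set \<Rightarrow> (int ^ 'd \<Rightarrow> complex) \<Rightarrow> real ^ 'd \<Rightarrow> real" where
  "trig_poly \<Lambda> p \<theta> = Re (\<Sum>k\<in>\<Lambda>. p k * exp (- \<i> * complex_of_real (idx_inner k \<theta>)))"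

definition pairing :: "(int ^ 'd) set \<Rightarrow> (int ^ 'd \<Rightarrow> complex) \<Rightarrow> (int ^ 'd \<Rightarrow> complex) \<Rightarrow> real" where
  "pairing \<Lambda> c p = Re (\<Sum>k\<in>\<Lambda>. c k * cnj (p k))"

definition pos_polys :: "(int ^ 'd) set \<Rightarrow> (int ^ 'd \<Rightarrow> complex) set" where
  "pos_polys \<Lambda> = {p \<in> coeffs \<Lambda>. \<forall>\<theta>\<in>torus. 0 < trig_poly \<Lambda> p \<theta>}"

text \<open>The closure is taken in the topology of pointwise convergence of coefficients, which on
  \<open>coeffs \<Lambda>\<close> is the usual finite-dimensional topology. It consists of the nonnegative
  polynomials, see \<open>closed_pos_polys_eq_nonneg\<close> below.\<close>

definition closed_pos_polys :: "(int ^ 'd) set \<Rightarrow> (int ^ 'd \<Rightarrow> complex) set" where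
  "closed_pos_polys \<Lambda> = closure (pos_polys \<Lambda>)"

definition pos_polys_normalized :: "(int ^ 'd) set \<Rightarrow> (int ^ 'd \<Rightarrow> complex) set" where
  "pos_polys_normalized \<Lambda> = {p \<in> pos_polys \<Lambda>. p 0 = 1}"

definition closed_pos_polys_normalized :: "(int ^ 'd) set \<Rightarrow> (int ^ 'd \<Rightarrow> complex) set" where
  "closed_pos_polys_normalized \<Lambda> = {p \<in> closed_pos_polys \<Lambda>. p 0 = 1}"

definition dual_cone :: "(int ^ 'd) set \<Rightarrow> (int ^ 'd \<Rightarrow> complex) set" where
  "dual_cone \<Lambda> = {c \<in> coeffs \<Lambda>. \<forall>p \<in> closed_pos_polys \<Lambda> - {\<lambda>_. 0}. 0 < pairing \<Lambda> c p}"

text \<open>Lebesgue integral of an extended-real function, as the integral of the positive part minus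
  that of the negative part (\<open>e2ennreal\<close> sends negative values to 0). It is meant for functions
  for which at most one of the two is infinite. This is the case in both uses below: for
  nonnegative trigonometric polynomials \<open>P\<close>, \<open>Q\<close> the function \<open>P log (P/Q)\<close> is bounded below,
  and for integrable \<open>\<Phi> \<ge> 0\<close> the positive part of \<open>log \<Phi>\<close> is at most \<open>\<Phi>\<close>.\<close>

definition ext_integral :: "'a measure \<Rightarrow> ('a \<Rightarrow> ereal) \<Rightarrow> ereal" where
  "ext_integral M f =
     enn2ereal (\<integral>\<^sup>+x. e2ennreal (f x) \<partial>M) - enn2ereal (\<integral>\<^sup>+x. e2ennreal (- f x) \<partial>M)"

definition ext_ln :: "real \<Rightarrow> ereal" where
  "ext_ln x = (if x \<le> 0 then - \<infinity> else ereal (ln x))"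

text \<open>\<open>p log (p/q)\<close> for \<open>p, q \<ge> 0\<close>, with \<open>0 log 0 = 0\<close>.\<close>

definition entropy_integrand :: "real \<Rightarrow> real \<Rightarrow> ereal" where
  "entropy_integrand p q = (if p = 0 then 0 else if q = 0 then \<infinity> else ereal (p * ln (p / q)))"

definition dual_objective ::
  "(int ^ 'd) set \<Rightarrow> (int ^ 'd \<Rightarrow> complex) \<Rightarrow> (int ^ 'd \<Rightarrow> complex)
    \<Rightarrow> (int ^ 'd \<Rightarrow> complex) \<times> (int ^ 'd \<Rightarrow> complex) \<Rightarrow> ereal" where
  "dual_objective \<Lambda> c \<gamma> = (\<lambda>(p, q).
     if \<forall>\<theta>\<in>torus. trig_poly \<Lambda> q \<theta> = 0 then \<infinity>
     else ereal (pairing \<Lambda> c q - pairing \<Lambda> \<gamma> p)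
       + ext_integral torus_measure (\<lambda>\<theta>. entropy_integrand (trig_poly \<Lambda> p \<theta>) (trig_poly \<Lambda> q \<theta>)))"

definition dual_feasible ::
  "(int ^ 'd) set \<Rightarrow> ((int ^ 'd \<Rightarrow> complex) \<times> (int ^ 'd \<Rightarrow> complex)) set" where
  "dual_feasible \<Lambda> = closed_pos_polys_normalized \<Lambda> \<times> closed_pos_polys \<Lambda>"

definition dual_optimal ::
  "(int ^ 'd) set \<Rightarrow> (int ^ 'd \<Rightarrow> complex) \<Rightarrow> (int ^ 'd \<Rightarrow> complex)
    \<Rightarrow> (int ^ 'd \<Rightarrow> complex) \<times> (int ^ 'd \<Rightarrow> complex) \<Rightarrow> bool" where
  "dual_optimal \<Lambda> c \<gamma> = is_arg_min (dual_objective \<Lambda> c \<gamma>) (\<lambda>x. x \<in> dual_feasible \<Lambda>)"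

text \<open>The function type carries no \<open>real_vector\<close> structure, so convexity of a minimization problem
  over pairs of coefficient families (convex feasible set \<open>F\<close>, convex objective \<open>J\<close>) is written
  out with pointwise combinations.\<close>

definition convex_comb :: "real \<Rightarrow> ('a \<Rightarrow> complex) \<Rightarrow> ('a \<Rightarrow> complex) \<Rightarrow> 'a \<Rightarrow> complex" where
  "convex_comb t p p' = (\<lambda>k. of_real (1 - t) * p k + of_real t * p' k)"

definition convex_problem ::
  "(('a \<Rightarrow> complex) \<times> ('a \<Rightarrow> complex) \<Rightarrow> ereal) \<Rightarrow> (('a \<Rightarrow> complex) \<times> ('a \<Rightarrow> complex)) set \<Rightarrow> bool" where
  "convex_problem J F \<longleftrightarrow>
     (\<forall>(p, q)\<in>F. \<forall>(p', q')\<in>F. \<forall>t\<in>{0..1}.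
        (convex_comb t p p', convex_comb t q q') \<in> F \<and>
        J (convex_comb t p p', convex_comb t q q')
          \<le> ereal (1 - t) * J (p, q) + ereal t * J (p', q'))"

text \<open>Since \<open>ln 0 = 0\<close> in the library, positivity almost everywhere and integrability of the
  logarithm are required explicitly: otherwise the logarithmic moment does not exist.\<close>

definition has_log_moment :: "(real ^ 'd \<Rightarrow> real) \<Rightarrow> int ^ 'd \<Rightarrow> complex \<Rightarrow> bool" where
  "has_log_moment \<Phi> k g \<longleftrightarrow>
     (AE \<theta> in torus_measure. 0 < \<Phi> \<theta>) \<and>
     integrable torus_measure (\<lambda>\<theta>. ln (\<Phi> \<theta>)) \<and>
     g = (LINT \<theta>|torus_measure. character k \<theta> * complex_of_real (ln (\<Phi> \<theta>)))"

definition primal_objective :: "(real ^ 'd \<Rightarrow> real) \<Rightarrow> ereal" where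
  "primal_objective \<Phi> = ext_integral torus_measure (\<lambda>\<theta>. ext_ln (\<Phi> \<theta>))"

definition primal_feasible ::
  "(int ^ 'd) set \<Rightarrow> (int ^ 'd \<Rightarrow> complex) \<Rightarrow> (int ^ 'd \<Rightarrow> complex) \<Rightarrow> (real ^ 'd \<Rightarrow> real) set" where
  "primal_feasible \<Lambda> c \<gamma> = {\<Phi>.
     (\<forall>\<theta>\<in>torus. 0 \<le> \<Phi> \<theta>) \<and> integrable torus_measure \<Phi> \<and>
     (\<forall>k\<in>\<Lambda> - {0}. has_log_moment \<Phi> k (\<gamma> k)) \<and>
     (\<forall>k\<in>\<Lambda>. c k = (LINT \<theta>|torus_measure. character k \<theta> * complex_of_real (\<Phi> \<theta>)))}"

definition primal_optimal ::
  "(int ^ 'd) set \<Rightarrow> (int ^ 'd \<Rightarrow> complex) \<Rightarrow> (int ^ 'd \<Rightarrow> complex) \<Rightarrow> (real ^ 'd \<Rightarrow> real) \<Rightarrow> bool" where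
  "primal_optimal \<Lambda> c \<gamma> = is_arg_max primal_objective (\<lambda>\<Phi>. \<Phi> \<in> primal_feasible \<Lambda> c \<gamma>)"


lemma cnj_hermitian_sum:
  fixes f :: "int ^ 'd \<Rightarrow> complex"
  assumes "uminus ` \<Lambda> = \<Lambda>" and "\<And>k. k \<in> \<Lambda> \<Longrightarrow> f (- k) = cnj (f k)"
  shows "complex_of_real (Re (\<Sum>k\<in>\<Lambda>. f k)) = (\<Sum>k\<in>\<Lambda>. f k)"
proof -
  have "cnj (\<Sum>k\<in>\<Lambda>. f k) = (\<Sum>k\<in>\<Lambda>. f (- k))"
    using assms(2) by simp
  also have "\<dots> = (\<Sum>k\<in>uminus ` \<Lambda>. f k)"
    by (subst sum.reindex) (auto simp: inj_on_def)
  finally have "cnj (\<Sum>k\<in>\<Lambda>. f k) = (\<Sum>k\<in>\<Lambda>. f k)"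
    using assms(1) by simp
  then show ?thesis
    by (metis Reals_cnj_iff of_real_Re)
qed

lemma of_real_trig_poly:
  assumes "uminus ` \<Lambda> = \<Lambda>" "p \<in> coeffs \<Lambda>"
  shows "complex_of_real (trig_poly \<Lambda> p \<theta>)
    = (\<Sum>k\<in>\<Lambda>. p k * exp (- \<i> * complex_of_real (idx_inner k \<theta>)))"
  unfolding trig_poly_def
proof (rule cnj_hermitian_sum[OF assms(1)])
  fix k assume "k \<in> \<Lambda>"
  then show "p (- k) * exp (- \<i> * complex_of_real (idx_inner (- k) \<theta>))
      = cnj (p k * exp (- \<i> * complex_of_real (idx_inner k \<theta>)))"
    using assms(2) by (simp add: coeffs_def exp_cnj idx_inner_def sum_negf)
qed

lemma of_real_pairing:
  assumes "uminus ` \<Lambda> = \<Lambda>" "\<And>k. k \<in> \<Lambda> \<Longrightarrow> c (- k) = cnj (c k)" "p \<in> coeffs \<Lambda>"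
  shows "complex_of_real (pairing \<Lambda> c p) = (\<Sum>k\<in>\<Lambda>. c k * cnj (p k))"
  unfolding pairing_def
  by (rule cnj_hermitian_sum[OF assms(1)]) (use assms(2,3) in \<open>auto simp: coeffs_def\<close>)

lemma closed_pos_polys_eq_nonneg:
  fixes \<Lambda> :: "(int ^ 'd) set"
  assumes "finite \<Lambda>" "0 \<in> \<Lambda>"
  shows "closed_pos_polys \<Lambda> = {p \<in> coeffs \<Lambda>. \<forall>\<theta>\<in>torus. 0 \<le> trig_poly \<Lambda> p \<theta>}" (is "_ = ?N")
proof
  have "?N = (\<Inter>k\<in>- \<Lambda>. {p. p k = 0}) \<inter> (\<Inter>k\<in>\<Lambda>. {p. p (- k) = cnj (p k)})
      \<inter> (\<Inter>\<theta>\<in>torus. {p. 0 \<le> trig_poly \<Lambda> p \<theta>})"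
    by (auto simp: coeffs_def)
  also have "closed \<dots>"
    unfolding trig_poly_def
    by (intro closed_Int closed_INT ballI closed_Collect_eq closed_Collect_le continuous_intros
        continuous_on_product_coordinates)
  finally show "closed_pos_polys \<Lambda> \<subseteq> ?N"
    unfolding closed_pos_polys_def
    by (intro closure_minimal) (auto simp: pos_polys_def less_imp_le)
next
  show "?N \<subseteq> closed_pos_polys \<Lambda>"
  proof
    fix p assume p: "p \<in> ?N"
    define g :: "real \<Rightarrow> int ^ 'd \<Rightarrow> complex" where
      "g e = (\<lambda>k. p k + (if k = 0 then of_real e else 0))" for e
    have tp: "trig_poly \<Lambda> (g e) \<theta> = trig_poly \<Lambda> p \<theta> + e" for e \<theta>
    proof -
      have "(\<Sum>k\<in>\<Lambda>. g e k * exp (- \<i> * complex_of_real (idx_inner k \<theta>)))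
          = (\<Sum>k\<in>\<Lambda>. p k * exp (- \<i> * complex_of_real (idx_inner k \<theta>))
              + (if k = 0 then of_real e else 0))"
        by (rule sum.cong) (auto simp: g_def idx_inner_def)
      then show ?thesis
        using assms by (simp add: trig_poly_def sum.distrib)
    qed
    have "continuous_on UNIV (\<lambda>e. g e k)" for k
      by (cases "k = 0") (auto simp: g_def intro!: continuous_intros)
    then have "continuous_on UNIV g"
      by (intro continuous_on_coordinatewise_then_product) auto
    moreover have "g ` {0<..} \<subseteq> pos_polys \<Lambda>"
      using p assms(2) unfolding pos_polys_def
      by (auto simp: tp add_nonneg_pos) (auto simp: coeffs_def g_def)
    ultimately have "g ` closure {0<..} \<subseteq> closure (pos_polys \<Lambda>)"
      by (intro image_closure_subset) (auto intro: continuous_on_subset closure_subset[THEN subsetD])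
    moreover have "g 0 = p"
      by (auto simp: g_def)
    ultimately show "p \<in> closed_pos_polys \<Lambda>"
      unfolding closed_pos_polys_def by force
  qed
qed

lemma ext_integral_ereal:
  assumes "integrable M f"
  shows "ext_integral M (\<lambda>x. ereal (f x)) = ereal (LINT x|M. f x)"
proof -
  have "integrable M (\<lambda>x. - f x)"
    using assms by simp
  then have *: "(\<integral>\<^sup>+x. ennreal (f x) \<partial>M) < top" "(\<integral>\<^sup>+x. ennreal (- f x) \<partial>M) < top"
    using assms by (auto simp: real_integrable_def less_top)
  then show ?thesis
    using real_lebesgue_integral_def[OF assms]
    by (cases "\<integral>\<^sup>+x. ennreal (f x) \<partial>M"; cases "\<integral>\<^sup>+x. ennreal (- f x) \<partial>M")
      (auto simp: ext_integral_def ennreal.rep_eq simp flip: ennreal.abs_eq)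
qed

end

theory Submission
  imports Defs
begin

text \<open>The objective is a linear functional plus the integral of \<open>kl(P, Q) = P log (P/Q) - P + Q \<ge> 0\<close>,
  and \<open>kl(p, q)\<close> is the supremum over \<open>s > 0\<close> of the affine functions \<open>p log s + (1 - s) q\<close>. This
  yields convexity, lower semicontinuity (by Fatou), and, for a fixed small \<open>s\<close>, a lower bound that
  grows linearly in \<open>q\<^sub>0\<close> because \<open>\<langle>c, q\<rangle> \<ge> \<epsilon> q\<^sub>0\<close>; hence a minimizer exists. At an interior minimizer,
  comparison with \<open>(P, Q + t R)\<close> and \<open>(P + t R, Q)\<close> up to terms of order \<open>t\<^sup>2\<close> gives the two moment
  conditions, and \<open>log x \<le> x - 1\<close> gives optimality for the primal problem. Finally, if \<open>Q\<close> has a zero,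
  comparing \<open>Q\<close> with \<open>Q + t\<close> and letting \<open>t\<close> tend to 0 shows that \<open>1/Q\<close> is integrable, which is
  impossible for \<open>d \<le> 2\<close> because \<open>Q\<close> vanishes to second order at its zeros.\<close>

section \<open>Trigonometric polynomials on the torus\<close>

text \<open>Passing to \<open>kl\<close> costs only a linear term, because the added
  \<open>Q - P\<close> integrates to \<open>q 0 - p 0\<close>, and it leaves a nonnegative
  integrand, for which infinite integrals are harmless. The normalization \<open>p 0 = 1\<close>
  acts in three places. A nonnegative polynomial satisfies |p_k| \<le> p_0, so the \<open>P\<close>
  component ranges over a compact set. A zero \<open>Q\<close> gets an infinite divergence.
  Admissible directions for \<open>P\<close> have zeroth coefficient 0, so stationarity leaves the
  zeroth logarithmic moment free, which is exactly the quantity that the primal problem maximizes.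
  At an interior optimum \<open>t\<close> may have either sign, and explicit quadratic remainders
  replace differentiation under the integral. When \<open>Q\<close> has zeros, only
  \<open>t > 0\<close> is allowed along the direction 1; the resulting one-sided inequality is all
  that the integrability of \<open>1/Q\<close> requires.\<close>

lemma norm_character [simp]: "norm (character k \<theta>) = 1"
  by (simp add: character_def)

lemma character_zero [simp]: "character 0 \<theta> = 1"
  by (simp add: character_def idx_inner_def)

lemma cnj_character: "cnj (character k \<theta>) = character (- k) \<theta>"
  by (simp add: character_def exp_cnj idx_inner_def sum_negf)

lemma character_add: "character (j + k) \<theta> = character j \<theta> * character k \<theta>"
  by (simp add: character_def idx_inner_def ring_distribs sum.distrib exp_add)

lemma continuous_on_idx_inner [continuous_intros]: "continuous_on S (idx_inner k)"
  unfolding idx_inner_def by (intro continuous_intros)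

lemma continuous_on_character [continuous_intros]: "continuous_on S (character k)"
proof -
  have "continuous_on S (\<lambda>\<theta>. exp (\<i> * complex_of_real (idx_inner k \<theta>)))"
    by (intro continuous_intros)
  then show ?thesis
    by (simp add: character_def[abs_def])
qed

lemma trig_poly_character: "trig_poly \<Lambda> p \<theta> = Re (\<Sum>k\<in>\<Lambda>. p k * cnj (character k \<theta>))"
proof -
  have "exp (- \<i> * complex_of_real (idx_inner k \<theta>)) = cnj (character k \<theta>)" for k
    by (simp add: character_def exp_cnj)
  then show ?thesis
    by (simp only: trig_poly_def)
qed

lemma continuous_on_trig_poly [continuous_intros]: "continuous_on S (trig_poly \<Lambda> p)"
proof -
  have "continuous_on S (\<lambda>\<theta>. Re (\<Sum>k\<in>\<Lambda>. p k * cnj (character k \<theta>)))"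
    by (intro continuous_intros)
  then show ?thesis
    by (simp add: trig_poly_character[abs_def])
qed

lemma abs_trig_poly_le: "\<bar>trig_poly \<Lambda> p \<theta>\<bar> \<le> (\<Sum>k\<in>\<Lambda>. norm (p k))"
proof -
  have "\<bar>trig_poly \<Lambda> p \<theta>\<bar> \<le> norm (\<Sum>k\<in>\<Lambda>. p k * cnj (character k \<theta>))"
    unfolding trig_poly_character by (rule abs_Re_le_cmod)
  also have "\<dots> \<le> (\<Sum>k\<in>\<Lambda>. norm (p k))"
    by (rule sum_norm_le) (simp add: norm_mult)
  finally show ?thesis .
qed

section \<open>Normalized Lebesgue measure on the torus\<close>

lemma borel_torus [measurable]: "torus \<in> sets borel"
  unfolding torus_def by measurable

lemma torus_subset_cbox: "torus \<subseteq> cbox (\<chi> j. - pi) (\<chi> j. pi)"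
  by (auto simp: torus_def mem_box_cart less_imp_le)

lemma space_torus_measure [simp]: "space torus_measure = torus"
  by (simp add: torus_measure_def)

lemma sets_torus_measure [measurable_cong]: "sets torus_measure = sets (lebesgue_on torus)"
  by (simp add: torus_measure_def)

lemma borel_measurable_torusI:
  assumes "continuous_on UNIV f"
  shows "f \<in> borel_measurable torus_measure"
proof -
  have "f \<in> borel_measurable lebesgue"
    using borel_measurable_continuous_onI[OF assms]
    by (rule measurable_completion[of f lborel, simplified])
  then have "f \<in> borel_measurable (lebesgue_on torus)"
    by (rule measurable_restrict_space1)
  then show ?thesis
    by (simp cong: measurable_cong_sets add: sets_torus_measure)
qed

lemma measurable_character [measurable]: "character k \<in> borel_measurable torus_measure"
  by (rule borel_measurable_torusI) (rule continuous_on_character)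

lemma measurable_trig_poly [measurable]: "trig_poly \<Lambda> p \<in> borel_measurable torus_measure"
  by (rule borel_measurable_torusI) (rule continuous_on_trig_poly)

lemma emeasure_torus_measure:
  assumes "S \<in> sets borel" "S \<subseteq> torus"
  shows "emeasure (torus_measure :: (real ^ 'd) measure) S
    = ennreal ((1 / (2 * pi)) ^ CARD('d)) * emeasure lborel S"
proof -
  have S: "S \<in> sets (lebesgue_on torus)"
    using assms by (auto simp: sets_restrict_space_iff)
  show ?thesis
    unfolding torus_measure_def using S assms
    by (simp add: emeasure_density_const emeasure_restrict_space)
qed

lemma finite_measure_torus: "finite_measure (torus_measure :: (real ^ 'd) measure)"
proof
  have "emeasure lborel (torus :: (real ^ 'd) set)
      \<le> emeasure lborel (cbox (\<chi> j. - pi) (\<chi> j. pi) :: (real ^ 'd) set)"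
    by (intro emeasure_mono torus_subset_cbox) auto
  also have "\<dots> < \<infinity>"
    by (rule emeasure_lborel_cbox_finite)
  finally show "emeasure (torus_measure :: (real ^ 'd) measure) (space torus_measure) \<noteq> \<infinity>"
    by (simp add: emeasure_torus_measure ennreal_mult_eq_top_iff)
qed

text \<open>Takes an integral over the completed, restricted and rescaled measure back to
  \<open>lborel\<close>, where the product structure is available.\<close>

lemma integral_torus_measure:
  fixes f :: "real ^ 'd \<Rightarrow> complex"
  assumes "continuous_on UNIV f"
  shows "(LINT \<theta>|torus_measure. f \<theta>)
    = (1 / (2 * pi)) ^ CARD('d) *\<^sub>R (LINT \<theta>|lborel. indicator torus \<theta> *\<^sub>R f \<theta>)"
proof -
  have [measurable]: "f \<in> borel_measurable borel"
    by (rule borel_measurable_continuous_onI[OF assms])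
  have [measurable]: "f \<in> borel_measurable (lebesgue_on torus)"
    using borel_measurable_torusI[OF assms]
    by (simp cong: measurable_cong_sets add: sets_torus_measure)
  have "(LINT \<theta>|torus_measure. f \<theta>) = (LINT \<theta>|lebesgue_on torus. (1 / (2 * pi)) ^ CARD('d) *\<^sub>R f \<theta>)"
    unfolding torus_measure_def by (rule integral_density) auto
  also have "\<dots> = (1 / (2 * pi)) ^ CARD('d) *\<^sub>R (LINT \<theta>|lebesgue. indicator torus \<theta> *\<^sub>R f \<theta>)"
    by (simp add: integral_restrict_space)
  also have "(LINT \<theta>|lebesgue. indicator torus \<theta> *\<^sub>R f \<theta>) = (LINT \<theta>|lborel. indicator torus \<theta> *\<^sub>R f \<theta>)"
    by (rule integral_completion) measurable
  finally show ?thesis .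
qed

section \<open>Orthogonality of the characters\<close>

lemma integral_exp_period:
  fixes n :: int
  shows "(LINT x|lborel. indicator {- pi<..pi} x *\<^sub>R exp (\<i> * complex_of_real (of_int n * x)))
    = (if n = 0 then of_real (2 * pi) else 0)"
proof -
  \<comment> \<open>The point -\<pi> is null; on the closed interval the fundamental theorem of
    calculus applies.\<close>
  have eq: "(LINT x|lborel. indicator {- pi<..pi} x *\<^sub>R exp (\<i> * complex_of_real (of_int n * x)))
    = (LINT x|lborel. indicator {- pi..pi} x *\<^sub>R exp (\<i> * complex_of_real (of_int n * x)))"
  proof (rule integral_cong_AE)
    show "AE x in lborel. indicator {- pi<..pi} x *\<^sub>R exp (\<i> * complex_of_real (of_int n * x)) =
         indicator {- pi..pi} x *\<^sub>R exp (\<i> * complex_of_real (of_int n * x))"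
      using AE_lborel_singleton[of "- pi"] by eventually_elim (auto simp: indicator_def)
  qed measurable
  show ?thesis
  proof (cases "n = 0")
    case True
    then show ?thesis unfolding eq by (simp add: scaleR_conv_of_real)
  next
    case False
    define F where "F x = exp (\<i> * complex_of_real (of_int n * x)) / (\<i> * of_int n)" for x
    have "(LINT x|lborel. indicator {- pi..pi} x *\<^sub>R exp (\<i> * complex_of_real (of_int n * x))) = F pi - F (- pi)"
    proof (rule integral_FTC_atLeastAtMost)
      fix x
      show "(F has_vector_derivative exp (\<i> * complex_of_real (of_int n * x))) (at x within {- pi..pi})"
        unfolding F_def using False
        by (auto intro!: derivative_eq_intros has_vector_derivative_real_field simp: field_simps)
    qed (auto intro!: continuous_intros)
    \<comment> \<open>The two exponents differ by 2 \<pi> i n, a period of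
      \<open>exp\<close>.\<close>
    also have "exp (\<i> * complex_of_real (of_int n * pi)) = exp (\<i> * complex_of_real (of_int n * - pi))"
      by (rule exp_eq[THEN iffD2]) (auto intro!: exI[of _ n] simp: algebra_simps)
    then have "F pi - F (- pi) = 0"
      by (simp add: F_def)
    finally show ?thesis
      unfolding eq using False by simp
  qed
qed

text \<open>The integrand factors over the coordinates, so the integral over the product measure is
  a product of one-variable integrals, and one nonzero component of \<open>k\<close> already
  contributes a factor 0. For \<open>k = 0\<close> the value 1 says that the measure is
  normalized.\<close>

lemma integral_character:
  fixes k :: "int ^ 'd"
  shows "(LINT \<theta>|torus_measure. character k \<theta>) = (if k = 0 then 1 else 0)"
proof -
  \<comment> \<open>\<open>K\<close> is \<open>k\<close> as a real vector; its components are read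
    off as inner products with \<open>Basis\<close>, the index set of the product measure behind
    \<open>lborel\<close>.\<close>
  define K :: "real ^ 'd" where "K = (\<chi> j. of_int (k $ j))"
  define f where "f b x = indicator {- pi<..pi} x *\<^sub>R exp (\<i> * complex_of_real ((K \<bullet> b) * x))" for b x
  interpret product_sigma_finite "\<lambda>_. lborel :: real measure" ..
  have inner: "(\<Sum>b\<in>Basis. x b *\<^sub>R b) \<bullet> b = x b" if "b \<in> Basis" for x and b :: "real ^ 'd"
    using that by (simp add: inner_sum_left_Basis)
  have Kint: "\<exists>n. K \<bullet> b = of_int n" if "b \<in> Basis" for b
    using that by (auto simp: Basis_vec_def K_def inner_axis)
  have f_int: "(LINT x|lborel. f b x) = (if K \<bullet> b = 0 then of_real (2 * pi) else 0)" if b: "b \<in> Basis" for b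
  proof -
    obtain n where n: "K \<bullet> b = of_int n" using Kint[OF b] by blast
    show ?thesis
      unfolding f_def n by (subst integral_exp_period) simp
  qed
  have int_f: "integrable lborel (f b)" for b
  proof -
    have "integrable lborel (\<lambda>x. indicator {- pi<..pi} x *\<^sub>R exp (\<i> * complex_of_real ((K \<bullet> b) * x)))"
      by (rule integrableI_bounded_set_indicator[where B=1]) auto
    then show ?thesis by (simp add: f_def[abs_def])
  qed
  have char: "indicator torus \<theta> *\<^sub>R character k \<theta> = (\<Prod>b\<in>Basis. f b (\<theta> \<bullet> b))" for \<theta>
  proof -
    have "idx_inner k \<theta> = K \<bullet> \<theta>"
      by (simp add: idx_inner_def K_def inner_vec_def)
    also have "\<dots> = (\<Sum>b\<in>Basis. (K \<bullet> b) * (\<theta> \<bullet> b))"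
      by (rule euclidean_inner)
    finally have 1: "character k \<theta> = (\<Prod>b\<in>Basis. exp (\<i> * complex_of_real ((K \<bullet> b) * (\<theta> \<bullet> b))))"
      by (simp add: character_def sum_distrib_left exp_sum)
    have "\<theta> \<in> torus \<longleftrightarrow> (\<forall>b\<in>Basis. \<theta> \<bullet> b \<in> {- pi<..pi})"
      by (auto simp: torus_def Basis_vec_def inner_axis)
    then have 2: "indicator torus \<theta> = (\<Prod>b\<in>Basis. indicator {- pi<..pi} (\<theta> \<bullet> b) :: real)"
      by (auto simp: indicator_def prod_zero_iff intro!: prod.neutral)
    show ?thesis
      unfolding 1 2 f_def by (simp add: scaleR_conv_of_real prod.distrib)
  qed
  have "(LINT \<theta>|lborel. indicator torus \<theta> *\<^sub>R character k \<theta>) = (LINT \<theta>|lborel. (\<Prod>b\<in>Basis. f b (\<theta> \<bullet> b)))"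
    by (simp add: char)
  also have "\<dots> = (LINT x|Pi\<^sub>M Basis (\<lambda>_. lborel). (\<Prod>b\<in>Basis. f b ((\<Sum>b\<in>Basis. x b *\<^sub>R b) \<bullet> (b :: real ^ 'd))))"
    by (subst lborel_eq, rule integral_distr) (auto simp: f_def)
  also have "\<dots> = (LINT x|Pi\<^sub>M (Basis :: (real ^ 'd) set) (\<lambda>_. lborel). (\<Prod>b\<in>Basis. f b (x b)))"
    by (intro Bochner_Integration.integral_cong refl prod.cong) (simp only: inner)
  also have "\<dots> = (\<Prod>b\<in>Basis. (LINT x|lborel. f b x))"
    by (intro product_integral_prod int_f) auto
  also have "\<dots> = (\<Prod>b\<in>Basis. if K \<bullet> b = 0 then of_real (2 * pi) else 0)"
    by (intro prod.cong refl f_int)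
  also have "\<dots> = (if k = 0 then of_real (2 * pi) ^ CARD('d) else 0)"
  proof (cases "k = 0")
    case True
    then have "K = 0" by (auto simp: K_def vec_eq_iff)
    with True show ?thesis by simp
  next
    case False
    then have "K \<noteq> 0" by (auto simp: K_def vec_eq_iff)
    then obtain b where "b \<in> Basis" "K \<bullet> b \<noteq> 0"
      using euclidean_all_zero_iff by blast
    then show ?thesis
      using False by (auto simp: prod_zero_iff)
  qed
  finally show ?thesis
    by (subst integral_torus_measure)
      (auto intro!: continuous_intros simp: scaleR_conv_of_real power_divide)
qed

lemma emeasure_torus: "emeasure (torus_measure :: (real ^ 'd) measure) torus = 1"
proof -
  interpret finite_measure "torus_measure :: (real ^ 'd) measure"
    by (rule finite_measure_torus)
  have "complex_of_real (measure (torus_measure :: (real ^ 'd) measure) torus) = 1"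
    using integral_character[of "0 :: int ^ 'd"] by (simp add: scaleR_conv_of_real)
  then have "measure (torus_measure :: (real ^ 'd) measure) torus = 1"
    by (metis of_real_eq_1_iff)
  then show ?thesis
    by (simp add: emeasure_eq_measure)
qed

section \<open>Integrability, moments and Fourier coefficients\<close>

lemma integrable_torusI:
  fixes f :: "real ^ 'd \<Rightarrow> 'a :: {banach, second_countable_topology}"
  assumes "f \<in> borel_measurable torus_measure" "\<And>\<theta>. \<theta> \<in> torus \<Longrightarrow> norm (f \<theta>) \<le> B"
  shows "integrable torus_measure f"
  by (rule finite_measure.integrable_const_bound[OF finite_measure_torus])
    (use assms in \<open>auto intro!: AE_I2\<close>)

lemma integrable_character [simp, intro]: "integrable torus_measure (character k)"
  by (rule integrable_torusI[where B=1]) auto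

lemma integrable_trig_poly [simp, intro]: "integrable torus_measure (trig_poly \<Lambda> p)"
  by (rule integrable_torusI) (auto intro: abs_trig_poly_le)

lemma integrable_trig_poly_mult:
  assumes "integrable torus_measure f"
  shows "integrable torus_measure (\<lambda>\<theta>. f \<theta> * trig_poly \<Lambda> r \<theta>)"
proof (rule Bochner_Integration.integrable_bound[where f="\<lambda>\<theta>. f \<theta> * (\<Sum>k\<in>\<Lambda>. norm (r k))"])
  show "AE x in torus_measure. norm (f x * trig_poly \<Lambda> r x) \<le> norm (f x * (\<Sum>k\<in>\<Lambda>. cmod (r k)))"
    using abs_trig_poly_le by (fastforce simp: abs_mult sum_nonneg intro!: AE_I2 mult_left_mono)
qed (use assms in auto)

lemma integrable_character_mult:
  assumes "integrable torus_measure f"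
  shows "integrable torus_measure (\<lambda>\<theta>. character k \<theta> * complex_of_real (f \<theta>))"
  by (rule Bochner_Integration.integrable_bound[OF assms]) (use assms in \<open>auto simp: norm_mult\<close>)

text \<open>Exchanging the finite sum with the integral translates between pairings with a moment
  sequence and integrals against a polynomial; both moment conditions and the primal bound rest on
  this.\<close>

lemma pairing_moments:
  assumes "finite \<Lambda>" "integrable torus_measure f"
  shows "pairing \<Lambda> (\<lambda>k. LINT \<theta>|torus_measure. character k \<theta> * complex_of_real (f \<theta>)) r
    = (LINT \<theta>|torus_measure. f \<theta> * trig_poly \<Lambda> r \<theta>)"
proof -
  note int = integrable_character_mult[OF assms(2)]
  have "(\<Sum>k\<in>\<Lambda>. (LINT \<theta>|torus_measure. character k \<theta> * complex_of_real (f \<theta>)) * cnj (r k))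
      = (LINT \<theta>|torus_measure. (\<Sum>k\<in>\<Lambda>. character k \<theta> * complex_of_real (f \<theta>) * cnj (r k)))"
    by (subst Bochner_Integration.integral_sum) (auto intro!: int)
  then have "pairing \<Lambda> (\<lambda>k. LINT \<theta>|torus_measure. character k \<theta> * complex_of_real (f \<theta>)) r
    = (LINT \<theta>|torus_measure. Re (\<Sum>k\<in>\<Lambda>. character k \<theta> * complex_of_real (f \<theta>) * cnj (r k)))"
    unfolding pairing_def
    by (subst integral_Re) (auto intro!: int)
  also have "(\<lambda>\<theta>. Re (\<Sum>k\<in>\<Lambda>. character k \<theta> * complex_of_real (f \<theta>) * cnj (r k)))
     = (\<lambda>\<theta>. f \<theta> * trig_poly \<Lambda> r \<theta>)"
  proof
    fix \<theta>
    show "Re (\<Sum>k\<in>\<Lambda>. character k \<theta> * complex_of_real (f \<theta>) * cnj (r k)) = f \<theta> * trig_poly \<Lambda> r \<theta>"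
      unfolding trig_poly_character Re_sum sum_distrib_left
      by (intro sum.cong refl) (simp add: algebra_simps)
  qed
  finally show ?thesis .
qed

text \<open>Orthogonality isolates the term with index \<open>k\<close>; for \<open>k\<close>
  outside \<Lambda> the result is still right, because members of \<open>coeffs\<close> are 0
  there.\<close>

lemma integral_character_trig_poly:
  assumes "finite \<Lambda>" "uminus ` \<Lambda> = \<Lambda>" "p \<in> coeffs \<Lambda>"
  shows "(LINT \<theta>|torus_measure. character k \<theta> * complex_of_real (trig_poly \<Lambda> p \<theta>)) = p k"
proof -
  have eq: "character k \<theta> * complex_of_real (trig_poly \<Lambda> p \<theta>) = (\<Sum>j\<in>\<Lambda>. p j * character (k - j) \<theta>)" for \<theta>
  proof -
    have "exp (- \<i> * complex_of_real (idx_inner j \<theta>)) = character (- j) \<theta>" for j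
      by (simp add: character_def idx_inner_def sum_negf)
    moreover have "character (k - j) \<theta> = character k \<theta> * character (- j) \<theta>" for j
      using character_add[of k "- j"] by simp
    ultimately show ?thesis
      unfolding of_real_trig_poly[OF assms(2,3)] by (simp add: sum_distrib_left mult.left_commute)
  qed
  have "(LINT \<theta>|torus_measure. character k \<theta> * complex_of_real (trig_poly \<Lambda> p \<theta>))
      = (LINT \<theta>|torus_measure. (\<Sum>j\<in>\<Lambda>. p j * character (k - j) \<theta>))"
    by (simp only: eq)
  also have "\<dots> = (\<Sum>j\<in>\<Lambda>. p j * (if j = k then 1 else 0))"
    by (subst Bochner_Integration.integral_sum) (auto simp: integral_character intro!: sum.cong)
  also have "\<dots> = p k"
    using assms(1,3) by (auto simp: coeffs_def if_distrib cong: if_cong)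
  finally show ?thesis .
qed

lemma integral_trig_poly:
  assumes "finite \<Lambda>" "0 \<in> \<Lambda>" "uminus ` \<Lambda> = \<Lambda>" "p \<in> coeffs \<Lambda>"
  shows "(LINT \<theta>|torus_measure. trig_poly \<Lambda> p \<theta>) = Re (p 0)"
proof -
  have "complex_of_real (LINT \<theta>|torus_measure. trig_poly \<Lambda> p \<theta>) = p 0"
    using integral_character_trig_poly[OF assms(1,3,4), of 0] by simp
  then show ?thesis
    by (metis Re_complex_of_real)
qed

text \<open>By nonnegativity the L^1 norm of the polynomial is its integral, and this is its zeroth
  coefficient. Bounding \<open>p 0\<close> therefore bounds every coefficient, which is the source
  of the compactness arguments below.\<close>

lemma coeff_le_zeroth:
  assumes "finite \<Lambda>" "0 \<in> \<Lambda>" "uminus ` \<Lambda> = \<Lambda>" "p \<in> coeffs \<Lambda>"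
    and "\<And>\<theta>. \<theta> \<in> torus \<Longrightarrow> 0 \<le> trig_poly \<Lambda> p \<theta>"
  shows "norm (p k) \<le> Re (p 0)"
proof -
  have "norm (p k) \<le> (LINT \<theta>|torus_measure. norm (character k \<theta> * complex_of_real (trig_poly \<Lambda> p \<theta>)))"
    using integral_norm_bound[of torus_measure "\<lambda>\<theta>. character k \<theta> * complex_of_real (trig_poly \<Lambda> p \<theta>)"]
    by (simp only: integral_character_trig_poly[OF assms(1,3,4)])
  also have "\<dots> = (LINT \<theta>|torus_measure. trig_poly \<Lambda> p \<theta>)"
    by (intro Bochner_Integration.integral_cong) (auto simp: norm_mult assms(5))
  finally show ?thesis
    by (simp add: integral_trig_poly[OF assms(1-4)])
qed

text \<open>\<open>torus\<close> is half-open and hence not compact. By periodicity, inequalities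
  may be moved between it, the closed box and the whole space.\<close>

lemma torus_representative:
  fixes \<theta> :: "real ^ 'd"
  obtains \<theta>' where "\<theta>' \<in> torus" "\<And>\<Lambda> p. trig_poly \<Lambda> p \<theta>' = trig_poly \<Lambda> p \<theta>"
proof -
  \<comment> \<open>The ceiling, not the floor, matches an interval that is open at -\<pi> and
    closed at \<pi>.\<close>
  define n where "n j = \<lceil>(\<theta> $ j - pi) / (2 * pi)\<rceil>" for j
  define \<theta>' :: "real ^ 'd" where "\<theta>' = (\<chi> j. \<theta> $ j - 2 * pi * of_int (n j))"
  have "\<theta>' \<in> torus"
  proof -
    have "- pi < \<theta> $ j - 2 * pi * of_int (n j) \<and> \<theta> $ j - 2 * pi * of_int (n j) \<le> pi" for j
    proof -
      have "of_int (n j) - 1 < (\<theta> $ j - pi) / (2 * pi)" "(\<theta> $ j - pi) / (2 * pi) \<le> of_int (n j)"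
        unfolding n_def by linarith+
      then show ?thesis by (simp add: field_simps)
    qed
    then show ?thesis by (simp add: torus_def \<theta>'_def)
  qed
  moreover have "character k \<theta>' = character k \<theta>" for k
  proof -
    define N where "N = (\<Sum>j\<in>UNIV. k $ j * n j)"
    have "idx_inner k \<theta> = idx_inner k \<theta>' + 2 * pi * of_int N"
      by (simp add: N_def idx_inner_def \<theta>'_def ring_distribs sum_subtractf sum_distrib_left mult_ac)
    then show ?thesis
      unfolding character_def
      by (intro exp_eq[THEN iffD2] exI[of _ "- N"]) (simp add: algebra_simps)
  qed
  ultimately show thesis
    by (intro that[of \<theta>']) (auto simp: trig_poly_character)
qed

lemma trig_poly_nonneg:
  assumes "\<And>\<theta>. \<theta> \<in> torus \<Longrightarrow> 0 \<le> trig_poly \<Lambda> p \<theta>"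
  shows "0 \<le> trig_poly \<Lambda> p \<theta>"
  by (metis assms torus_representative)

text \<open>The minimum exists on the closed box; its location may lie outside \<open>torus\<close>,
  so positivity there comes from a representative. The uniform bound is what keeps small
  perturbations positive.\<close>

lemma pos_polys_lower_bound:
  fixes p :: "int ^ 'd \<Rightarrow> complex"
  assumes "p \<in> pos_polys \<Lambda>"
  obtains e where "0 < e" "\<And>\<theta>. e \<le> trig_poly \<Lambda> p \<theta>"
proof -
  let ?K = "cbox (\<chi> j. - pi) (\<chi> j. pi) :: (real ^ 'd) set"
  have "0 \<in> ?K" by (simp add: mem_box_cart)
  then obtain m where m: "m \<in> ?K" "\<And>\<theta>. \<theta> \<in> ?K \<Longrightarrow> trig_poly \<Lambda> p m \<le> trig_poly \<Lambda> p \<theta>"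
    using continuous_attains_inf[of ?K "trig_poly \<Lambda> p"] by (auto intro!: continuous_intros)
  show thesis
  proof (rule that[of "trig_poly \<Lambda> p m"])
    obtain m' where "m' \<in> torus" "trig_poly \<Lambda> p m' = trig_poly \<Lambda> p m"
      by (metis torus_representative)
    then show "0 < trig_poly \<Lambda> p m"
      using assms by (force simp: pos_polys_def)
    fix \<theta> obtain t where "t \<in> torus" "trig_poly \<Lambda> p t = trig_poly \<Lambda> p \<theta>"
      by (metis torus_representative)
    then show "trig_poly \<Lambda> p m \<le> trig_poly \<Lambda> p \<theta>"
      using m(2)[of t] torus_subset_cbox by auto
  qed
qed

section \<open>Linearity, and separation of sequences by pairings\<close>

lemma trig_poly_linear:
  "trig_poly \<Lambda> (\<lambda>k. complex_of_real a * p k + complex_of_real b * q k) \<theta>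
    = a * trig_poly \<Lambda> p \<theta> + b * trig_poly \<Lambda> q \<theta>"
proof -
  have "Re ((complex_of_real a * x + complex_of_real b * y) * z) = a * Re (x * z) + b * Re (y * z)" for x y z
    by (simp add: algebra_simps)
  then show ?thesis
    by (simp only: trig_poly_character Re_sum sum_distrib_left sum.distrib)
qed

lemma pairing_linear:
  "pairing \<Lambda> c (\<lambda>k. complex_of_real a * p k + complex_of_real b * q k)
    = a * pairing \<Lambda> c p + b * pairing \<Lambda> c q"
proof -
  have "Re (z * cnj (complex_of_real a * x + complex_of_real b * y)) = a * Re (z * cnj x) + b * Re (z * cnj y)" for x y z
    by (simp add: algebra_simps)
  then show ?thesis
    by (simp only: pairing_def Re_sum sum_distrib_left sum.distrib)
qed

lemma coeffs_linear:
  assumes "p \<in> coeffs \<Lambda>" "q \<in> coeffs \<Lambda>"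
  shows "(\<lambda>k. complex_of_real a * p k + complex_of_real b * q k) \<in> coeffs \<Lambda>"
  using assms by (auto simp: coeffs_def)

lemma integrable_torus_continuous:
  fixes f :: "real ^ 'd \<Rightarrow> real"
  assumes "continuous_on UNIV f"
  shows "integrable torus_measure f"
proof -
  have "bounded (f ` cbox (\<chi> j. - pi) (\<chi> j. pi))"
    using assms by (intro compact_imp_bounded compact_continuous_image) (auto intro: continuous_on_subset)
  then obtain B where "\<And>\<theta>. \<theta> \<in> cbox (\<chi> j. - pi) (\<chi> j. pi) \<Longrightarrow> norm (f \<theta>) \<le> B"
    unfolding bounded_iff by blast
  then show ?thesis
    using torus_subset_cbox by (intro integrable_torusI[where B=B] borel_measurable_torusI assms) auto
qed

lemma moments_hermitian:
  "(LINT \<theta>|torus_measure. character (- k) \<theta> * complex_of_real (f \<theta>))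
    = cnj (LINT \<theta>|torus_measure. character k \<theta> * complex_of_real (f \<theta>))"
proof -
  have "(\<lambda>\<theta>. character (- k) \<theta> * complex_of_real (f \<theta>)) = (\<lambda>\<theta>. cnj (character k \<theta> * complex_of_real (f \<theta>)))"
    by (simp add: cnj_character)
  then show ?thesis
    by (simp only: Bochner_Integration.integral_cnj)
qed

text \<open>Testing with the difference of \<open>a\<close> and \<open>b\<close> on \<open>S\<close>
  turns equality of pairings into a vanishing sum of squares. \<open>S\<close> will be \<Lambda> for
  the ordinary moments and \<Lambda> without 0 for the logarithmic ones, whose test directions must
  vanish at 0.\<close>

lemma eq_of_pairing_eq:
  assumes fin: "finite \<Lambda>" and S: "S \<subseteq> \<Lambda>" "\<And>k. k \<in> S \<Longrightarrow> - k \<in> S"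
    and herm: "\<And>k. k \<in> S \<Longrightarrow> a (- k) = cnj (a k)" "\<And>k. k \<in> S \<Longrightarrow> b (- k) = cnj (b k)"
    and eq: "\<And>r. r \<in> coeffs \<Lambda> \<Longrightarrow> (\<And>k. k \<notin> S \<Longrightarrow> r k = 0) \<Longrightarrow> pairing \<Lambda> a r = pairing \<Lambda> b r"
    and k: "k \<in> S"
  shows "a k = b k"
proof -
  define r where "r k = (if k \<in> S then a k - b k else 0)" for k
  have "- k \<in> S \<longleftrightarrow> k \<in> S" for k
    using S(2)[of k] S(2)[of "- k"] by auto
  then have "r \<in> coeffs \<Lambda>"
    using S(1) by (auto simp: coeffs_def r_def herm)
  then have "pairing \<Lambda> a r = pairing \<Lambda> b r"
    by (rule eq) (simp add: r_def)
  then have "0 = (\<Sum>k\<in>\<Lambda>. Re (a k * cnj (r k)) - Re (b k * cnj (r k)))"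
    by (simp add: pairing_def sum_subtractf)
  also have "\<dots> = (\<Sum>k\<in>\<Lambda>. (norm (r k))\<^sup>2)"
  proof (intro sum.cong refl)
    fix k
    have "Re (a k * cnj (r k)) - Re (b k * cnj (r k)) = Re (r k * cnj (r k))"
      by (simp add: r_def algebra_simps)
    then show "Re (a k * cnj (r k)) - Re (b k * cnj (r k)) = (norm (r k))\<^sup>2"
      by (simp add: complex_mult_cnj cmod_power2)
  qed
  finally have "\<forall>k\<in>\<Lambda>. (norm (r k))\<^sup>2 = 0"
    using fin by (subst (asm) eq_commute, subst (asm) sum_nonneg_eq_0_iff) auto
  then show ?thesis
    using k S(1) by (force simp: r_def)
qed

section \<open>The entropy integrand\<close>

text \<open>The Bregman divergence of x log x, with its lower semicontinuous values on the boundary.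
  Values in \<open>ennreal\<close> give access to Fatou's lemma without integrability side
  conditions.\<close>

definition kl :: "real \<Rightarrow> real \<Rightarrow> ennreal" where
  "kl p q = (if p = 0 then ennreal q else if q = 0 then \<infinity> else ennreal (p * ln (p / q) - p + q))"

lemma kl_measurable [measurable (raw)]:
  assumes [measurable]: "f \<in> borel_measurable M" "g \<in> borel_measurable M"
  shows "(\<lambda>x. kl (f x) (g x)) \<in> borel_measurable M"
  unfolding kl_def by measurable

text \<open>The inequality log x \<le> x - 1 at \<open>x = s * q / p\<close>, multiplied by
  \<open>p\<close>. It is sharp at \<open>s = p / q\<close>, so \<open>s\<close> parametrizes the
  supporting planes of \<open>kl\<close>.\<close>

lemma kl_ge_affine:
  assumes "0 \<le> p" "0 \<le> q" "0 < s"
  shows "ennreal (p * ln s + (1 - s) * q) \<le> kl p q"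
proof (cases "p = 0 \<or> q = 0")
  case True
  then show ?thesis
    using assms by (auto simp: kl_def mult_left_le_one_le mult_le_cancel_right1 intro!: ennreal_leI)
next
  case False
  then have pq: "0 < p" "0 < q" using assms by auto
  have "ln (s * q / p) \<le> s * q / p - 1"
    using pq assms by (intro ln_le_minus_one) auto
  then have "p * ln (s * q / p) \<le> p * (s * q / p - 1)"
    using pq by (intro mult_left_mono) auto
  then have "p * (ln s + ln q - ln p) \<le> s * q - p"
    using pq assms by (simp add: ln_mult ln_div algebra_simps)
  then have "p * ln s + (1 - s) * q \<le> p * ln (p / q) - p + q"
    using pq by (simp add: ln_div algebra_simps)
  then show ?thesis
    using pq by (auto simp: kl_def intro!: ennreal_leI)
qed

text \<open>Being a supremum of affine functions, \<open>kl\<close> is jointly convex and lower semicontinuous.\<close>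

lemma kl_le_SUP_affine:
  assumes "0 \<le> p" "0 \<le> q"
  shows "kl p q \<le> (SUP s\<in>{0<..}. ennreal (p * ln s + (1 - s) * q))" (is "_ \<le> ?S")
proof -
  consider "p = 0" | "p > 0" "q = 0" | "p > 0" "q > 0"
    using assms by linarith
  then show ?thesis
  proof cases
    case 1
    \<comment> \<open>For \<open>q > 0\<close> the supremum is not attained; it is approached as
      \<open>s\<close> tends to 0.\<close>
    have "((\<lambda>s. ennreal ((1 - s) * q)) \<longlongrightarrow> ennreal ((1 - 0) * q)) (at_right 0)"
      by (intro tendsto_intros tendsto_ennrealI)
    moreover have "eventually (\<lambda>s. ennreal ((1 - s) * q) \<le> ?S) (at_right 0)"
      using eventually_at_right_less by eventually_elim (rule SUP_upper2, auto simp: 1)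
    ultimately have "ennreal ((1 - 0) * q) \<le> ?S"
      by (intro tendsto_upperbound) auto
    then show ?thesis by (simp add: 1 kl_def)
  next
    case 2
    \<comment> \<open>The choice \<open>s = exp (n / p)\<close> makes the affine function equal to
      \<open>n\<close>.\<close>
    have "of_nat n \<le> ?S" for n
      unfolding ennreal_of_nat_eq_real_of_nat
      by (rule SUP_upper2[of "exp (of_nat n / p)"]) (use 2 in auto)
    then have "(SUP n. of_nat n) \<le> ?S"
      by (rule SUP_least)
    then have "?S = \<infinity>"
      by (simp add: ennreal_SUP_of_nat_eq_top top_unique)
    then show ?thesis by (simp only: infinity_ennreal_def top_greatest)
  next
    case 3
    have "p * ln (p / q) - p + q = p * ln (p / q) + (1 - p / q) * q"
      using 3 by (simp add: left_diff_distrib)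
    then show ?thesis
      by (intro SUP_upper2[of "p / q"]) (use 3 in \<open>auto simp: kl_def intro: ennreal_leI\<close>)
  qed
qed

lemma kl_convex:
  assumes "0 \<le> p" "0 \<le> q" "0 \<le> p'" "0 \<le> q'" "0 \<le> a" "0 \<le> b"
  shows "kl (a * p + b * p') (a * q + b * q') \<le> ennreal a * kl p q + ennreal b * kl p' q'"
proof -
  have "ennreal ((a * p + b * p') * ln s + (1 - s) * (a * q + b * q'))
      \<le> ennreal a * kl p q + ennreal b * kl p' q'" if "0 < s" for s
  proof -
    let ?l = "\<lambda>p q. p * ln s + (1 - s) * q"
    have "ennreal (?l (a * p + b * p') (a * q + b * q')) = ennreal (a * ?l p q + b * ?l p' q')"
      by (simp add: algebra_simps)
    \<comment> \<open>\<open>ennreal\<close> sends negative numbers to 0 and is additive only on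
      nonnegative ones, so the truncation is made explicit before the sum is split.\<close>
    also have "\<dots> \<le> ennreal (a * max 0 (?l p q) + b * max 0 (?l p' q'))"
      using assms by (intro ennreal_leI add_mono mult_left_mono) auto
    also have "\<dots> = ennreal a * ennreal (?l p q) + ennreal b * ennreal (?l p' q')"
      using assms by (simp add: ennreal_plus ennreal_mult'' ennreal_mult' max_def ennreal_neg)
    also have "\<dots> \<le> ennreal a * kl p q + ennreal b * kl p' q'"
      using assms that by (intro add_mono mult_left_mono kl_ge_affine) auto
    finally show ?thesis .
  qed
  then show ?thesis
    by (intro order_trans[OF kl_le_SUP_affine] SUP_least) (use assms in auto)
qed

lemma kl_lsc:
  assumes "p \<longlonglongrightarrow> p0" "q \<longlonglongrightarrow> q0" "\<And>n. 0 \<le> p n" "\<And>n. 0 \<le> q n"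
  shows "kl p0 q0 \<le> liminf (\<lambda>n. kl (p n) (q n))"
proof -
  have "0 \<le> p0" "0 \<le> q0"
    using assms by (auto intro: LIMSEQ_le_const)
  moreover have "ennreal (p0 * ln s + (1 - s) * q0) \<le> liminf (\<lambda>n. kl (p n) (q n))" if "0 < s" for s
  proof -
    have "(\<lambda>n. ennreal (p n * ln s + (1 - s) * q n)) \<longlonglongrightarrow> ennreal (p0 * ln s + (1 - s) * q0)"
      by (intro tendsto_ennrealI tendsto_intros assms)
    then have "ennreal (p0 * ln s + (1 - s) * q0) = liminf (\<lambda>n. ennreal (p n * ln s + (1 - s) * q n))"
      by (metis lim_imp_Liminf trivial_limit_sequentially)
    also have "\<dots> \<le> liminf (\<lambda>n. kl (p n) (q n))"
      using assms that by (intro Liminf_mono always_eventually allI kl_ge_affine)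
    finally show ?thesis .
  qed
  ultimately show ?thesis
    by (intro order_trans[OF kl_le_SUP_affine] SUP_least) auto
qed

text \<open>Splits the integrand into a part of either sign that is integrable for polynomials and a
  nonnegative part. The boundary conventions match: for \<open>p = 0\<close> both sides are 0, for
  \<open>q = 0 < p\<close> both are infinite.\<close>

lemma entropy_integrand_eq_kl:
  assumes "0 \<le> p" "0 \<le> q"
  shows "entropy_integrand p q = ereal (p - q) + enn2ereal (kl p q)"
proof (cases "p = 0 \<or> q = 0")
  case True
  then show ?thesis
    using assms by (auto simp: entropy_integrand_def kl_def ennreal.rep_eq)
next
  case False
  then have "0 < p" "0 < q" using assms by auto
  then have "0 \<le> p * ln (p / q) - p + q"
    using kl_ge_affine[of p q "p / q"] ln_le_minus_one[of "q / p"]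
      mult_left_mono[of "ln (q / p)" "q / p - 1" p]
    by (simp add: ln_div algebra_simps)
  with False show ?thesis
    by (simp add: entropy_integrand_def kl_def ennreal.rep_eq)
qed

section \<open>Integrals of extended-real functions\<close>

lemma ext_integral_cong_AE:
  assumes "AE x in M. f x = g x"
  shows "ext_integral M f = ext_integral M g"
  unfolding ext_integral_def
  by (intro arg_cong2[where f="(-)"] arg_cong[where f=enn2ereal] nn_integral_cong_AE;
      use assms in eventually_elim) simp_all

text \<open>If \<open>h\<close> has infinite integral, then so has the positive part of the sum,
  because \<open>h\<close> is at most that part plus the negative part of \<open>g\<close>; the
  negative part of the sum is at most that of \<open>g\<close>, so no difference of infinities
  arises. Otherwise \<open>h\<close> is finite almost everywhere and the integral is an ordinary
  one.\<close>

lemma ext_integral_add_nonneg: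
  assumes g: "integrable M g" and [measurable]: "h \<in> borel_measurable M"
  shows "ext_integral M (\<lambda>x. ereal (g x) + enn2ereal (h x))
    = ereal (LINT x|M. g x) + enn2ereal (\<integral>\<^sup>+x. h x \<partial>M)"
proof (cases "(\<integral>\<^sup>+x. h x \<partial>M) = \<infinity>")
  case True
  have [measurable]: "g \<in> borel_measurable M" using g by auto
  have fin: "(\<integral>\<^sup>+x. ennreal (- g x) \<partial>M) < \<infinity>"
    using g by (simp add: real_integrable_def less_top)
  have "h x \<le> e2ennreal (ereal (g x) + enn2ereal (h x)) + ennreal (- g x)" for x
  proof (cases "h x")
    case (real r)
    have "ennreal r \<le> ennreal (max 0 (g x + r) + max 0 (- g x))"
      by (intro ennreal_leI) auto
    also have "\<dots> = ennreal (g x + r) + ennreal (- g x)"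
      by (simp add: ennreal_plus max_def ennreal_neg)
    finally show ?thesis
      using real by (simp add: ennreal.rep_eq e2ennreal_ereal)
  qed simp
  then have "(\<integral>\<^sup>+x. h x \<partial>M)
      \<le> (\<integral>\<^sup>+x. e2ennreal (ereal (g x) + enn2ereal (h x)) + ennreal (- g x) \<partial>M)"
    by (intro nn_integral_mono)
  also have "\<dots> = (\<integral>\<^sup>+x. e2ennreal (ereal (g x) + enn2ereal (h x)) \<partial>M) + (\<integral>\<^sup>+x. ennreal (- g x) \<partial>M)"
    by (intro nn_integral_add) measurable
  finally have pos: "(\<integral>\<^sup>+x. e2ennreal (ereal (g x) + enn2ereal (h x)) \<partial>M) = \<infinity>"
    using True fin by (auto simp: top_unique)
  have "e2ennreal (- (ereal (g x) + enn2ereal (h x))) \<le> ennreal (- g x)" for x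
    by (cases "h x") (auto simp: ennreal.rep_eq e2ennreal_neg intro!: ennreal_leI)
  then have "(\<integral>\<^sup>+x. e2ennreal (- (ereal (g x) + enn2ereal (h x))) \<partial>M) \<le> (\<integral>\<^sup>+x. ennreal (- g x) \<partial>M)"
    by (intro nn_integral_mono)
  with fin have "(\<integral>\<^sup>+x. e2ennreal (- (ereal (g x) + enn2ereal (h x))) \<partial>M) < \<infinity>"
    by (rule order_le_less_trans[rotated])
  with pos True show ?thesis
    by (cases "\<integral>\<^sup>+x. e2ennreal (- (ereal (g x) + enn2ereal (h x))) \<partial>M")
      (auto simp: ext_integral_def ennreal.rep_eq)
next
  case False
  then have fin: "(\<integral>\<^sup>+x. h x \<partial>M) < \<infinity>" by (simp add: less_top)
  have ae: "AE x in M. h x \<noteq> \<infinity>"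
    using False by (intro nn_integral_noteq_infinite) auto
  define r where "r x = enn2real (h x)" for x
  have [measurable]: "r \<in> borel_measurable M"
    unfolding r_def by measurable
  have hr: "AE x in M. h x = ennreal (r x)"
    using ae by eventually_elim (auto simp: r_def ennreal_enn2real_if)
  then have nn: "(\<integral>\<^sup>+x. h x \<partial>M) = (\<integral>\<^sup>+x. ennreal (r x) \<partial>M)"
    by (rule nn_integral_cong_AE)
  have r: "integrable M r"
    using fin nn by (intro integrableI_nonneg) (auto simp: r_def)
  have "ext_integral M (\<lambda>x. ereal (g x) + enn2ereal (h x)) = ext_integral M (\<lambda>x. ereal (g x + r x))"
  proof -
    have "AE x in M. ereal (g x) + enn2ereal (h x) = ereal (g x + r x)"
      using hr by eventually_elim (metis enn2ereal_ennreal enn2real_nonneg plus_ereal.simps(1) r_def)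
    then show ?thesis
      by (rule ext_integral_cong_AE)
  qed
  also have "\<dots> = ereal (LINT x|M. g x) + ereal (LINT x|M. r x)"
    using g r by (simp add: ext_integral_ereal)
  also have "ereal (LINT x|M. r x) = enn2ereal (\<integral>\<^sup>+x. h x \<partial>M)"
    unfolding nn using r by (subst nn_integral_eq_integral) (auto simp: r_def ennreal.rep_eq)
  finally show ?thesis .
qed

lemma primal_objective_eq:
  assumes "AE \<theta> in torus_measure. 0 < \<Phi> \<theta>" "integrable torus_measure (\<lambda>\<theta>. ln (\<Phi> \<theta>))"
  shows "primal_objective \<Phi> = ereal (LINT \<theta>|torus_measure. ln (\<Phi> \<theta>))"
proof -
  have "AE \<theta> in torus_measure. ext_ln (\<Phi> \<theta>) = ereal (ln (\<Phi> \<theta>))"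
    using assms(1) by eventually_elim (simp add: ext_ln_def)
  then have "primal_objective \<Phi> = ext_integral torus_measure (\<lambda>\<theta>. ereal (ln (\<Phi> \<theta>)))"
    unfolding primal_objective_def by (rule ext_integral_cong_AE)
  then show ?thesis
    by (simp add: ext_integral_ereal assms(2))
qed

text \<open>The bound log x \<le> x makes the integral of the positive part finite, so a logarithm
  that is not an integrable function must have an infinite negative part.\<close>

lemma primal_objective_minus_infinity:
  assumes int: "integrable torus_measure \<Phi>"
    and nonneg: "\<forall>\<theta>\<in>torus. 0 \<le> \<Phi> \<theta>"
    and bad: "\<not> ((AE \<theta> in torus_measure. 0 < \<Phi> \<theta>) \<and> integrable torus_measure (\<lambda>\<theta>. ln (\<Phi> \<theta>)))"
  shows "primal_objective \<Phi> = - \<infinity>"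
proof -
  let ?M = "torus_measure :: (real ^ 'a) measure"
  have [measurable]: "\<Phi> \<in> borel_measurable ?M"
    using int by auto
  have "e2ennreal (ext_ln x) \<le> ennreal x" for x
    using ln_bound[of x] by (auto simp: ext_ln_def e2ennreal_neg intro!: ennreal_leI)
  then have "(\<integral>\<^sup>+\<theta>. e2ennreal (ext_ln (\<Phi> \<theta>)) \<partial>?M) \<le> (\<integral>\<^sup>+\<theta>. ennreal (\<Phi> \<theta>) \<partial>?M)"
    by (intro nn_integral_mono)
  also have "\<dots> < \<infinity>"
    using int by (simp add: real_integrable_def less_top)
  finally have pos: "(\<integral>\<^sup>+\<theta>. e2ennreal (ext_ln (\<Phi> \<theta>)) \<partial>?M) < \<infinity>" .
  have neg: "(\<integral>\<^sup>+\<theta>. e2ennreal (- ext_ln (\<Phi> \<theta>)) \<partial>?M) = \<infinity>"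
  proof (rule ccontr)
    assume fin: "(\<integral>\<^sup>+\<theta>. e2ennreal (- ext_ln (\<Phi> \<theta>)) \<partial>?M) \<noteq> \<infinity>"
    have "(\<lambda>\<theta>. e2ennreal (- ext_ln (\<Phi> \<theta>))) \<in> borel_measurable ?M"
      unfolding ext_ln_def by measurable
    then have "AE \<theta> in ?M. e2ennreal (- ext_ln (\<Phi> \<theta>)) \<noteq> \<infinity>"
      using fin by (intro nn_integral_noteq_infinite)
    then have ae: "AE \<theta> in ?M. 0 < \<Phi> \<theta>"
      by eventually_elim (auto simp: ext_ln_def e2ennreal_infty not_le[symmetric])
    have "(\<integral>\<^sup>+\<theta>. ennreal (ln (\<Phi> \<theta>)) \<partial>?M) = (\<integral>\<^sup>+\<theta>. e2ennreal (ext_ln (\<Phi> \<theta>)) \<partial>?M)"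
        "(\<integral>\<^sup>+\<theta>. ennreal (- ln (\<Phi> \<theta>)) \<partial>?M) = (\<integral>\<^sup>+\<theta>. e2ennreal (- ext_ln (\<Phi> \<theta>)) \<partial>?M)"
      by (intro nn_integral_cong_AE; use ae in eventually_elim; simp add: ext_ln_def)+
    then have "integrable ?M (\<lambda>\<theta>. ln (\<Phi> \<theta>))"
      using pos fin by (simp add: real_integrable_def less_top)
    with ae bad show False by blast
  qed
  show ?thesis
    using pos neg unfolding primal_objective_def ext_integral_def
    by (cases "\<integral>\<^sup>+\<theta>. e2ennreal (ext_ln (\<Phi> \<theta>)) \<partial>?M") (auto simp: ennreal.rep_eq)
qed

section \<open>Zeros of nonnegative trigonometric polynomials\<close>

lemma one_minus_cos_le: "1 - cos x \<le> x\<^sup>2 / 2" for x :: real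
proof -
  have "1 - cos x = 2 * (sin (x / 2))\<^sup>2"
    using cos_double_sin[of "x / 2"] by simp
  also have "(sin (x / 2))\<^sup>2 \<le> (x / 2)\<^sup>2"
    using abs_sin_x_le_abs_x[of "x / 2"] by (metis abs_le_square_iff)
  finally show ?thesis
    by (simp add: power2_eq_square)
qed

text \<open>Nonnegativity bounds \<open>Q(\<theta> + v)\<close> by the sum \<open>Q(\<theta> + v) + Q(\<theta> - v)\<close>, whose terms carry a factor
  \<open>cos (k, v)\<close>.\<close>

lemma trig_poly_quadratic_bound:
  assumes nonneg: "\<And>\<theta>. 0 \<le> trig_poly \<Lambda> q \<theta>" and root: "trig_poly \<Lambda> q \<theta> = 0"
  shows "trig_poly \<Lambda> q (\<theta> + v) \<le> (\<Sum>k\<in>\<Lambda>. norm (q k) * (idx_inner k v)\<^sup>2)"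
proof -
  have add: "character k (\<theta> + w) = character k \<theta> * character k w" for k w
    by (simp add: character_def idx_inner_def ring_distribs sum.distrib exp_add)
  have minus: "character k (\<theta> - v) = character k \<theta> * cnj (character k v)" for k
    using add[of k "- v"] by (simp add: character_def idx_inner_def sum_negf exp_cnj)
  have cos: "character k v + cnj (character k v) = complex_of_real (2 * cos (idx_inner k v))" for k
    by (simp add: complex_eq_iff character_def Re_exp Im_exp)
  \<comment> \<open>The subtracted term is 0. It turns the sum into a second difference, so that
    each factor becomes 2 cos (k, v) - 2, which is of second order in \<open>v\<close>.\<close>
  have "trig_poly \<Lambda> q (\<theta> + v) \<le> trig_poly \<Lambda> q (\<theta> + v) + trig_poly \<Lambda> q (\<theta> - v) - 2 * trig_poly \<Lambda> q \<theta>"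
    using nonneg[of "\<theta> - v"] root by simp
  also have "\<dots> = (\<Sum>k\<in>\<Lambda>. Re (q k * cnj (character k \<theta>) *
      (cnj (character k v + cnj (character k v)) - 2)))"
    unfolding trig_poly_character Re_sum add minus sum_distrib_left sum.distrib[symmetric] sum_subtractf[symmetric]
    by (intro sum.cong refl) (simp add: algebra_simps)
  also have "\<dots> \<le> (\<Sum>k\<in>\<Lambda>. norm (q k) * (idx_inner k v)\<^sup>2)"
  proof (rule sum_mono)
    fix k
    have "Re (q k * cnj (character k \<theta>) * (cnj (character k v + cnj (character k v)) - 2))
        \<le> norm (q k * cnj (character k \<theta>) * (cnj (character k v + cnj (character k v)) - 2))"
      by (rule complex_Re_le_cmod)
    also have "\<dots> = norm (q k) * norm (complex_of_real (2 * cos (idx_inner k v) - 2))"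
      unfolding cos by (simp add: norm_mult)
    also have "\<dots> \<le> norm (q k) * (idx_inner k v)\<^sup>2"
      using one_minus_cos_le[of "idx_inner k v"] cos_le_one[of "idx_inner k v"]
      unfolding norm_of_real by (intro mult_left_mono) auto
    finally show "Re (q k * cnj (character k \<theta>) * (cnj (character k v + cnj (character k v)) - 2))
        \<le> norm (q k) * (idx_inner k v)\<^sup>2" .
  qed
  finally show ?thesis .
qed

lemma measure_torus_cbox:
  fixes a b :: "real ^ 'd"
  assumes "cbox a b \<subseteq> torus" "\<And>j. a $ j \<le> b $ j"
  shows "measure torus_measure (cbox a b) = (1 / (2 * pi)) ^ CARD('d) * (\<Prod>j\<in>UNIV. b $ j - a $ j)"
proof -
  have "cbox a b \<noteq> {}"
    using assms(2) by (auto simp: interval_ne_empty_cart)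
  then have "measure lborel (cbox a b) = (\<Prod>j\<in>UNIV. b $ j - a $ j)"
    by (rule content_cbox_cart)
  then show ?thesis
    using assms(1) by (simp add: measure_def emeasure_torus_measure enn2real_mult)
qed

text \<open>A nonnegative trigonometric polynomial vanishes at least quadratically at a zero, and
  \<open>\<bar>\<theta>\<bar>\<^sup>-\<^sup>2\<close> is not integrable near 0 in dimension at most 2.\<close>

lemma not_integrable_inverse_trig_poly:
  fixes q :: "int ^ 'd \<Rightarrow> complex"
  assumes d: "CARD('d) \<le> 2"
    and nonneg: "\<And>\<theta>. 0 \<le> trig_poly \<Lambda> q \<theta>" and root: "\<theta>0 \<in> torus" "trig_poly \<Lambda> q \<theta>0 = 0"
    and ae: "AE \<theta> in torus_measure. 0 < trig_poly \<Lambda> q \<theta>"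
  shows "\<not> integrable torus_measure (\<lambda>\<theta>. 1 / trig_poly \<Lambda> q \<theta>)"
proof
  let ?M = "torus_measure :: (real ^ 'd) measure"
  let ?Q = "trig_poly \<Lambda> q"
  assume int: "integrable ?M (\<lambda>\<theta>. 1 / ?Q \<theta>)"
  define h where "h n = inverse (real (Suc n))" for n
  have h: "0 < h n" "h n \<le> 1" for n
    by (auto simp: h_def field_simps)
  have h_lim: "h \<longlonglongrightarrow> 0"
    unfolding h_def by (rule LIMSEQ_inverse_real_of_nat)
  \<comment> \<open>A cube of side \<open>h n\<close> with vertex \<theta>0, extended from it
    towards the inside of the torus. A centred cube could leave the torus, since \<theta>0 may lie
    on a face where a coordinate is \<pi>.\<close>
  define a where "a n = (\<chi> j. if 0 < \<theta>0 $ j then \<theta>0 $ j - h n else \<theta>0 $ j)" for n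
  define b where "b n = (\<chi> j. if 0 < \<theta>0 $ j then \<theta>0 $ j else \<theta>0 $ j + h n)" for n
  have B_sub: "cbox (a n) (b n) \<subseteq> torus" for n
  proof
    fix \<theta> assume \<theta>: "\<theta> \<in> cbox (a n) (b n)"
    have "- pi < \<theta> $ j \<and> \<theta> $ j \<le> pi" for j
    proof -
      have "a n $ j \<le> \<theta> $ j" "\<theta> $ j \<le> b n $ j" "- pi < \<theta>0 $ j" "\<theta>0 $ j \<le> pi"
        using \<theta> root(1) by (auto simp: mem_box_cart torus_def)
      then show ?thesis
        using h[of n] pi_gt3 by (cases "0 < \<theta>0 $ j") (auto simp: a_def b_def)
    qed
    then show "\<theta> \<in> torus" by (simp add: torus_def)
  qed
  have B_dist: "\<bar>\<theta> $ j - \<theta>0 $ j\<bar> \<le> h n" if "\<theta> \<in> cbox (a n) (b n)" for \<theta> n j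
  proof -
    have "a n $ j \<le> \<theta> $ j" "\<theta> $ j \<le> b n $ j"
      using that by (auto simp: mem_box_cart)
    then show ?thesis
      using h[of n] by (cases "0 < \<theta>0 $ j") (auto simp: a_def b_def)
  qed
  have B_meas: "measure ?M (cbox (a n) (b n)) = (1 / (2 * pi)) ^ CARD('d) * h n ^ CARD('d)" for n
  proof -
    have "b n $ j - a n $ j = h n" for j
      by (simp add: a_def b_def)
    moreover have "a n $ j \<le> b n $ j" for j
      using h[of n] by (simp add: a_def b_def)
    ultimately show ?thesis
      using measure_torus_cbox[OF B_sub] by simp
  qed
  have B_sets [measurable]: "cbox (a n) (b n) \<in> sets ?M" for n
    using B_sub[of n] by (auto simp: sets_torus_measure sets_restrict_space_iff)
  \<comment> \<open>On the cube |(k, v)| \<le> |k|_1 h, which gives the sum; the added 1 makes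
    \<open>K\<close> positive, so that it can be divided by.\<close>
  define K where "K = (\<Sum>k\<in>\<Lambda>. norm (q k) * (\<Sum>j\<in>UNIV. \<bar>of_int (k $ j)\<bar>)\<^sup>2) + 1"
  have K: "0 < K"
    unfolding K_def by (intro add_nonneg_pos sum_nonneg) auto
  have Q_le: "?Q \<theta> \<le> K * (h n)\<^sup>2" if \<theta>: "\<theta> \<in> cbox (a n) (b n)" for \<theta> n
  proof -
    have "(idx_inner k (\<theta> - \<theta>0))\<^sup>2 \<le> (\<Sum>j\<in>UNIV. \<bar>of_int (k $ j)\<bar>)\<^sup>2 * (h n)\<^sup>2" for k
    proof -
      have "\<bar>idx_inner k (\<theta> - \<theta>0)\<bar> \<le> (\<Sum>j\<in>UNIV. \<bar>of_int (k $ j) * (\<theta> - \<theta>0) $ j\<bar>)"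
        unfolding idx_inner_def by (rule sum_abs)
      also have "\<dots> \<le> (\<Sum>j\<in>UNIV. \<bar>of_int (k $ j)\<bar> * h n)"
        using B_dist[OF \<theta>] by (intro sum_mono) (auto simp: abs_mult intro: mult_left_mono)
      also have "\<dots> = (\<Sum>j\<in>UNIV. \<bar>of_int (k $ j)\<bar>) * h n"
        by (simp add: sum_distrib_right)
      finally show ?thesis
        using power_mono[where n=2] by (fastforce simp flip: power_mult_distrib)
    qed
    then have "(\<Sum>k\<in>\<Lambda>. norm (q k) * (idx_inner k (\<theta> - \<theta>0))\<^sup>2)
        \<le> (\<Sum>k\<in>\<Lambda>. norm (q k) * ((\<Sum>j\<in>UNIV. \<bar>of_int (k $ j)\<bar>)\<^sup>2 * (h n)\<^sup>2))"
      by (intro sum_mono mult_left_mono) auto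
    also have "\<dots> \<le> K * (h n)\<^sup>2"
      by (simp add: K_def sum_distrib_right distrib_right mult.assoc)
    finally show ?thesis
      using trig_poly_quadratic_bound[OF nonneg root(2), of "\<theta> - \<theta>0"] by simp
  qed
  \<comment> \<open>The cube has volume of order h^d, and \<open>1/Q\<close> is at least 1/(K h^2)
    almost everywhere on it. For d \<le> 2 and h \<le> 1 the product has a positive lower bound
    independent of \<open>n\<close>; this is where the dimension enters.\<close>
  have lower: "(1 / (2 * pi)) ^ CARD('d) / K \<le> (LINT \<theta>|?M. indicator (cbox (a n) (b n)) \<theta> * (1 / ?Q \<theta>))" for n
  proof -
    have "h n ^ 2 \<le> h n ^ CARD('d)"
      using h[of n] d by (intro power_decreasing) auto
    then have "1 / K \<le> h n ^ CARD('d) * (1 / (K * (h n)\<^sup>2))"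
      using h[of n] K by (simp add: field_simps)
    then have "(1 / (2 * pi)) ^ CARD('d) * (1 / K)
        \<le> (1 / (2 * pi)) ^ CARD('d) * (h n ^ CARD('d) * (1 / (K * (h n)\<^sup>2)))"
      by (intro mult_left_mono) auto
    also have "\<dots> = (LINT \<theta>|?M. indicator (cbox (a n) (b n)) \<theta> * (1 / (K * (h n)\<^sup>2)))"
      using B_meas[of n] B_sub[of n] by (simp add: Int_absorb2)
    also have "\<dots> \<le> (LINT \<theta>|?M. indicator (cbox (a n) (b n)) \<theta> * (1 / ?Q \<theta>))"
    proof (rule integral_mono_AE)
      show "integrable ?M (\<lambda>\<theta>. indicator (cbox (a n) (b n)) \<theta> * (1 / (K * (h n)\<^sup>2)))"
        by (intro integrable_torusI[where B="1 / (K * (h n)\<^sup>2)"]) (use K in \<open>auto simp: indicator_def\<close>)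
      show "integrable ?M (\<lambda>\<theta>. indicator (cbox (a n) (b n)) \<theta> * (1 / ?Q \<theta>))"
        using integrable_mult_indicator[OF B_sets int] by simp
      show "AE \<theta> in ?M. indicator (cbox (a n) (b n)) \<theta> * (1 / (K * (h n)\<^sup>2))
          \<le> indicator (cbox (a n) (b n)) \<theta> * (1 / ?Q \<theta>)"
        using ae
      proof eventually_elim
        case (elim \<theta>)
        have "0 < K * (h n)\<^sup>2 * ?Q \<theta>"
          using elim K h(1)[of n] by simp
        then show ?case
          using divide_left_mono[OF Q_le, of \<theta> n 1] by (auto simp: indicator_def mult.commute)
      qed
    qed
    finally show ?thesis by simp
  qed
  \<comment> \<open>The cubes shrink to the point \<theta>0, so domination by an integrable
    \<open>1/Q\<close> forces these integrals to 0, against \<open>lower\<close>.\<close>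
  have "(\<lambda>n. LINT \<theta>|?M. indicator (cbox (a n) (b n)) \<theta> * (1 / ?Q \<theta>)) \<longlonglongrightarrow> (LINT \<theta>|?M. 0)"
  proof (rule integral_dominated_convergence[where w="\<lambda>\<theta>. 1 / ?Q \<theta>"])
    show "AE \<theta> in ?M. (\<lambda>n. indicator (cbox (a n) (b n)) \<theta> * (1 / ?Q \<theta>)) \<longlonglongrightarrow> 0"
      using ae
    proof eventually_elim
      fix \<theta> assume "0 < ?Q \<theta>"
      then have "\<theta> \<noteq> \<theta>0" using root(2) by auto
      then obtain j where j: "0 < \<bar>\<theta> $ j - \<theta>0 $ j\<bar>" by (auto simp: vec_eq_iff)
      have "eventually (\<lambda>n. h n < \<bar>\<theta> $ j - \<theta>0 $ j\<bar>) sequentially"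
        using h_lim j by (rule order_tendstoD)
      then have "eventually (\<lambda>n. indicator (cbox (a n) (b n)) \<theta> * (1 / ?Q \<theta>) = 0) sequentially"
      proof eventually_elim
        case (elim n)
        then have "\<theta> \<notin> cbox (a n) (b n)"
          using B_dist[of \<theta> n j] by auto
        then show ?case by simp
      qed
      then show "(\<lambda>n. indicator (cbox (a n) (b n)) \<theta> * (1 / ?Q \<theta>)) \<longlonglongrightarrow> 0"
        by (rule tendsto_eventually)
    qed
    show "AE \<theta> in ?M. norm (indicator (cbox (a n) (b n)) \<theta> * (1 / ?Q \<theta>)) \<le> 1 / ?Q \<theta>" for n
      using nonneg by (auto simp: indicator_def)
  qed (use int in \<open>auto intro!: borel_measurable_times borel_measurable_indicator B_sets\<close>)
  then have "(1 / (2 * pi)) ^ CARD('d) / K \<le> (LINT \<theta>|?M. (0 :: real))"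
    by (rule LIMSEQ_le_const) (use lower in auto)
  moreover have "0 < (1 / (2 * pi)) ^ CARD('d) / K"
    using K by (intro divide_pos_pos zero_less_power) auto
  ultimately show False by simp
qed

section \<open>The dual problem\<close>

text \<open>Tychonoff's theorem: coefficient families are functions on all multi-indices, so they
  live in an infinite product rather than in a Euclidean space.\<close>

lemma compact_coordinate_balls: "compact {p :: 'a \<Rightarrow> complex. \<forall>k. norm (p k) \<le> B}"
proof -
  have "compactin (product_topology (\<lambda>_. euclidean) UNIV) (Pi\<^sub>E UNIV (\<lambda>_. cball 0 B) :: ('a \<Rightarrow> complex) set)"
    by (subst compactin_PiE) simp
  moreover have "(Pi\<^sub>E UNIV (\<lambda>_. cball 0 B) :: ('a \<Rightarrow> complex) set) = {p. \<forall>k. norm (p k) \<le> B}"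
    by (auto simp: PiE_iff)
  ultimately show ?thesis
    by (simp add: euclidean_product_topology)
qed

lemma tendsto_coordinate:
  fixes f :: "'a \<Rightarrow> 'b \<Rightarrow> complex"
  assumes "(f \<longlongrightarrow> l) F"
  shows "((\<lambda>n. f n k) \<longlongrightarrow> l k) F"
  by (rule continuous_on_tendsto_compose[OF continuous_on_product_coordinates assms]) auto

lemma abs_pairing_le: "\<bar>pairing \<Lambda> c p\<bar> \<le> (\<Sum>k\<in>\<Lambda>. norm (c k) * norm (p k))"
proof -
  have "\<bar>pairing \<Lambda> c p\<bar> \<le> norm (\<Sum>k\<in>\<Lambda>. c k * cnj (p k))"
    unfolding pairing_def by (rule abs_Re_le_cmod)
  also have "\<dots> \<le> (\<Sum>k\<in>\<Lambda>. norm (c k) * norm (p k))"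
    by (rule sum_norm_le) (simp add: norm_mult)
  finally show ?thesis .
qed

text \<open>Distributivity with a possibly infinite summand; at \<open>t = 0\<close> both sides are
  0 because zero times infinity is 0. This lets convexity be checked up to the endpoints of a
  segment.\<close>

lemma scaled_shift_ereal:
  assumes "0 \<le> t"
  shows "ereal t * (ereal a + enn2ereal K) = ereal (t * a) + enn2ereal (ennreal t * K)"
proof (cases K)
  case (real r)
  with assms show ?thesis
    by (simp add: ennreal.rep_eq distrib_left flip: ennreal_mult)
next
  case top
  with assms show ?thesis
    by (cases "t = 0") (auto simp: ennreal_mult_top ereal_mult_infty zero_ennreal.rep_eq)
qed

locale symmetric_index_set =
  fixes \<Lambda> :: "(int ^ 'd) set"
  assumes fin: "finite \<Lambda>" and zero: "0 \<in> \<Lambda>" and sym: "uminus ` \<Lambda> = \<Lambda>"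
begin

lemma closed_pos_polys_iff:
  "p \<in> closed_pos_polys \<Lambda> \<longleftrightarrow> p \<in> coeffs \<Lambda> \<and> (\<forall>\<theta>. 0 \<le> trig_poly \<Lambda> p \<theta>)"
  using trig_poly_nonneg[of \<Lambda> p] closed_pos_polys_eq_nonneg[OF fin zero] by auto

lemma coeff_bound: "p \<in> closed_pos_polys \<Lambda> \<Longrightarrow> norm (p k) \<le> Re (p 0)"
  by (rule coeff_le_zeroth[OF fin zero sym]) (auto simp: closed_pos_polys_iff)

lemma zeroth_real: "p \<in> coeffs \<Lambda> \<Longrightarrow> p 0 = of_real (Re (p 0))"
  using zero by (force simp: coeffs_def complex_eq_iff)

lemma integral_poly: "p \<in> coeffs \<Lambda> \<Longrightarrow> (LINT \<theta>|torus_measure. trig_poly \<Lambda> p \<theta>) = Re (p 0)"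
  by (rule integral_trig_poly[OF fin zero sym])

text \<open>The constant polynomial 1. Taken for both components it is a feasible point of finite
  value, and it is the direction in which a \<open>Q\<close> with zeros is shifted.\<close>

definition one_poly :: "int ^ 'd \<Rightarrow> complex" where
  "one_poly = (\<lambda>k. if k = 0 then 1 else 0)"

lemma one_poly_coeffs: "one_poly \<in> coeffs \<Lambda>"
  using zero by (auto simp: coeffs_def one_poly_def)

lemma trig_poly_one: "trig_poly \<Lambda> one_poly \<theta> = 1"
proof -
  have "(\<Sum>k\<in>\<Lambda>. one_poly k * cnj (character k \<theta>)) = (\<Sum>k\<in>\<Lambda>. if k = 0 then 1 else 0)"
    by (intro sum.cong) (auto simp: one_poly_def)
  then show ?thesis
    using fin zero by (simp add: trig_poly_character)
qed

lemma feasible_iff: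
  "(p, q) \<in> dual_feasible \<Lambda> \<longleftrightarrow>
     p \<in> coeffs \<Lambda> \<and> (\<forall>\<theta>. 0 \<le> trig_poly \<Lambda> p \<theta>) \<and> p 0 = 1 \<and>
     q \<in> coeffs \<Lambda> \<and> (\<forall>\<theta>. 0 \<le> trig_poly \<Lambda> q \<theta>)"
  by (auto simp: dual_feasible_def closed_pos_polys_normalized_def closed_pos_polys_iff)

definition divergence :: "(int ^ 'd \<Rightarrow> complex) \<Rightarrow> (int ^ 'd \<Rightarrow> complex) \<Rightarrow> ennreal" where
  "divergence p q = (\<integral>\<^sup>+\<theta>. kl (trig_poly \<Lambda> p \<theta>) (trig_poly \<Lambda> q \<theta>) \<partial>torus_measure)"

text \<open>The last two terms are the integral of \<open>P - Q\<close>, the part of the entropy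
  integrand that \<open>kl\<close> leaves out.\<close>

definition linear_part ::
  "(int ^ 'd \<Rightarrow> complex) \<Rightarrow> (int ^ 'd \<Rightarrow> complex) \<Rightarrow> (int ^ 'd \<Rightarrow> complex) \<Rightarrow> (int ^ 'd \<Rightarrow> complex) \<Rightarrow> real"
where
  "linear_part c \<gamma> p q = pairing \<Lambda> c q - pairing \<Lambda> \<gamma> p + Re (p 0) - Re (q 0)"

text \<open>The normalization of \<open>p\<close> makes the divergence infinite for \<open>q = 0\<close>, so that this case needs
  no separate treatment.\<close>

lemma dual_objective_eq:
  assumes pq: "(p, q) \<in> dual_feasible \<Lambda>"
  shows "dual_objective \<Lambda> c \<gamma> (p, q) = ereal (linear_part c \<gamma> p q) + enn2ereal (divergence p q)"
proof (cases "\<forall>\<theta>\<in>torus. trig_poly \<Lambda> q \<theta> = 0")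
  case True
  have "divergence p q = \<infinity>"
  proof (rule ccontr)
    assume "divergence p q \<noteq> \<infinity>"
    then have "AE \<theta> in torus_measure. kl (trig_poly \<Lambda> p \<theta>) (trig_poly \<Lambda> q \<theta>) \<noteq> \<infinity>"
      unfolding divergence_def by (intro nn_integral_noteq_infinite) auto
    then have "AE \<theta> in torus_measure. trig_poly \<Lambda> p \<theta> = 0"
      using AE_space by eventually_elim (use True in \<open>auto simp: kl_def split: if_splits\<close>)
    then have "(LINT \<theta>|torus_measure. trig_poly \<Lambda> p \<theta>) = 0"
      by (rule integral_eq_zero_AE)
    then show False
      using pq by (simp add: integral_poly feasible_iff)
  qed
  with True show ?thesis
    by (simp add: dual_objective_def)
next
  case False
  have "ext_integral torus_measure (\<lambda>\<theta>. entropy_integrand (trig_poly \<Lambda> p \<theta>) (trig_poly \<Lambda> q \<theta>))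
      = ext_integral torus_measure (\<lambda>\<theta>. ereal (trig_poly \<Lambda> p \<theta> - trig_poly \<Lambda> q \<theta>)
          + enn2ereal (kl (trig_poly \<Lambda> p \<theta>) (trig_poly \<Lambda> q \<theta>)))"
    using pq by (simp add: entropy_integrand_eq_kl feasible_iff)
  also have "\<dots> = ereal (Re (p 0) - Re (q 0)) + enn2ereal (divergence p q)"
    using pq by (subst ext_integral_add_nonneg) (auto simp: divergence_def integral_poly feasible_iff)
  finally have "dual_objective \<Lambda> c \<gamma> (p, q) = ereal (pairing \<Lambda> c q - pairing \<Lambda> \<gamma> p)
      + (ereal (Re (p 0) - Re (q 0)) + enn2ereal (divergence p q))"
    by (simp only: dual_objective_def prod.case False if_False)
  moreover have "linear_part c \<gamma> p q = (pairing \<Lambda> c q - pairing \<Lambda> \<gamma> p) + (Re (p 0) - Re (q 0))"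
    by (simp add: linear_part_def)
  ultimately show ?thesis
    by (simp only: plus_ereal.simps(1)[symmetric] add.assoc)
qed

lemma convex_problem_dual: "convex_problem (dual_objective \<Lambda> c \<gamma>) (dual_feasible \<Lambda>)"
  unfolding convex_problem_def
proof (clarify, intro conjI)
  fix p q p' q' and t :: real
  assume pq: "(p, q) \<in> dual_feasible \<Lambda>" and pq': "(p', q') \<in> dual_feasible \<Lambda>" and t: "t \<in> {0..1}"
  let ?p = "convex_comb t p p'" and ?q = "convex_comb t q q'"
  have tp: "trig_poly \<Lambda> (convex_comb t x x') \<theta> = (1 - t) * trig_poly \<Lambda> x \<theta> + t * trig_poly \<Lambda> x' \<theta>" for x x' \<theta>
    unfolding convex_comb_def by (rule trig_poly_linear)
  have cf: "convex_comb t x x' \<in> coeffs \<Lambda>" if "x \<in> coeffs \<Lambda>" "x' \<in> coeffs \<Lambda>" for x x'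
    unfolding convex_comb_def by (rule coeffs_linear[OF that])
  show feas: "(?p, ?q) \<in> dual_feasible \<Lambda>"
    using pq pq' t by (auto simp: feasible_iff tp cf) (simp add: convex_comb_def flip: of_real_add)
  have lin: "linear_part c \<gamma> ?p ?q = (1 - t) * linear_part c \<gamma> p q + t * linear_part c \<gamma> p' q'"
    unfolding linear_part_def convex_comb_def pairing_linear by (simp add: algebra_simps)
  have "divergence ?p ?q \<le> (\<integral>\<^sup>+\<theta>. ennreal (1 - t) * kl (trig_poly \<Lambda> p \<theta>) (trig_poly \<Lambda> q \<theta>)
        + ennreal t * kl (trig_poly \<Lambda> p' \<theta>) (trig_poly \<Lambda> q' \<theta>) \<partial>torus_measure)"
    unfolding divergence_def tp using pq pq' t
    by (intro nn_integral_mono kl_convex) (auto simp: feasible_iff)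
  also have "\<dots> = ennreal (1 - t) * divergence p q + ennreal t * divergence p' q'"
    unfolding divergence_def by (simp add: nn_integral_add nn_integral_cmult)
  finally have "enn2ereal (divergence ?p ?q)
      \<le> enn2ereal (ennreal (1 - t) * divergence p q) + enn2ereal (ennreal t * divergence p' q')"
    by (simp add: less_eq_ennreal.rep_eq plus_ennreal.rep_eq)
  then have "ereal (linear_part c \<gamma> ?p ?q) + enn2ereal (divergence ?p ?q)
    \<le> (ereal ((1 - t) * linear_part c \<gamma> p q) + ereal (t * linear_part c \<gamma> p' q'))
      + (enn2ereal (ennreal (1 - t) * divergence p q) + enn2ereal (ennreal t * divergence p' q'))"
    unfolding lin by (intro add_mono) auto
  also have "\<dots> = (ereal ((1 - t) * linear_part c \<gamma> p q) + enn2ereal (ennreal (1 - t) * divergence p q))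
      + (ereal (t * linear_part c \<gamma> p' q') + enn2ereal (ennreal t * divergence p' q'))"
    by (simp only: ac_simps)
  also have "\<dots> = ereal (1 - t) * (ereal (linear_part c \<gamma> p q) + enn2ereal (divergence p q))
      + ereal t * (ereal (linear_part c \<gamma> p' q') + enn2ereal (divergence p' q'))"
    using t by (simp only: scaled_shift_ereal atLeastAtMost_iff diff_ge_0_iff_ge)
  finally show "dual_objective \<Lambda> c \<gamma> (?p, ?q)
      \<le> ereal (1 - t) * dual_objective \<Lambda> c \<gamma> (p, q) + ereal t * dual_objective \<Lambda> c \<gamma> (p', q')"
    by (simp only: dual_objective_eq[OF feas] dual_objective_eq[OF pq] dual_objective_eq[OF pq'])
qed

section \<open>Compactness, coercivity and existence of a minimizer\<close>

lemma closed_closed_pos_polys: "closed (closed_pos_polys \<Lambda>)"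
  by (simp add: closed_pos_polys_def)

lemma continuous_on_pairing: "continuous_on UNIV (pairing \<Lambda> c)"
  unfolding pairing_def by (intro continuous_intros continuous_on_product_coordinates)

text \<open>In this cone the zeroth coefficient dominates all the others, so bounding it alone gives
  a closed subset of a product of balls.\<close>

lemma compact_bounded_pos_polys: "compact {p \<in> closed_pos_polys \<Lambda>. Re (p 0) \<le> B}"
proof -
  have "{p \<in> closed_pos_polys \<Lambda>. Re (p 0) \<le> B}
      = {p. \<forall>k. norm (p k) \<le> B} \<inter> (closed_pos_polys \<Lambda> \<inter> {p. Re (p 0) \<le> B})"
    using coeff_bound by (auto intro: order_trans)
  also have "compact \<dots>"
    by (intro compact_Int_closed compact_coordinate_balls closed_Int closed_closed_pos_polys closed_Collect_le
        continuous_intros continuous_on_product_coordinates)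
  finally show ?thesis .
qed

lemma closed_coordinate_eq: "closed {p :: int ^ 'd \<Rightarrow> complex. p 0 = a}"
  by (intro closed_Collect_eq continuous_intros continuous_on_product_coordinates)

lemma compact_closed_pos_polys_normalized: "compact (closed_pos_polys_normalized \<Lambda>)"
proof -
  have "closed_pos_polys_normalized \<Lambda> = {p \<in> closed_pos_polys \<Lambda>. Re (p 0) \<le> 1} \<inter> {p. p 0 = 1}"
    by (auto simp: closed_pos_polys_normalized_def)
  also have "compact \<dots>"
    by (intro compact_Int_closed compact_bounded_pos_polys closed_coordinate_eq)
  finally show ?thesis .
qed

lemma one_poly_normalized: "one_poly \<in> closed_pos_polys_normalized \<Lambda>"
  by (simp add: closed_pos_polys_normalized_def closed_pos_polys_iff one_poly_coeffs trig_poly_one)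
    (simp add: one_poly_def)

text \<open>\<open>e\<close> is the minimum of the pairing over the compact slice
  \<open>q 0 = 1\<close>, positive by the definition of \<open>dual_cone\<close>. Homogeneity
  extends the bound to \<open>q 0 > 0\<close>, and \<open>q 0 = 0\<close> forces
  \<open>q = 0\<close>.\<close>

lemma dual_cone_coercive:
  assumes "c \<in> dual_cone \<Lambda>"
  obtains e where "0 < e" "\<And>q. q \<in> closed_pos_polys \<Lambda> \<Longrightarrow> e * Re (q 0) \<le> pairing \<Lambda> c q"
proof -
  let ?K = "closed_pos_polys_normalized \<Lambda>"
  obtain m where m: "m \<in> ?K" "\<And>q. q \<in> ?K \<Longrightarrow> pairing \<Lambda> c m \<le> pairing \<Lambda> c q"
    using continuous_attains_inf[OF compact_closed_pos_polys_normalized]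
      one_poly_normalized continuous_on_subset[OF continuous_on_pairing] by blast
  have "m \<noteq> (\<lambda>_. 0)"
    using m(1) by (auto simp: closed_pos_polys_normalized_def)
  then have "0 < pairing \<Lambda> c m"
    using assms m(1) by (auto simp: dual_cone_def closed_pos_polys_normalized_def)
  then show thesis
  proof (rule that)
    fix q assume q: "q \<in> closed_pos_polys \<Lambda>"
    then have q': "q \<in> coeffs \<Lambda>" by (simp add: closed_pos_polys_iff)
    show "pairing \<Lambda> c m * Re (q 0) \<le> pairing \<Lambda> c q"
    proof (cases "Re (q 0) = 0")
      case True
      then have "norm (q k) \<le> 0" for k
        using coeff_bound[OF q] by metis
      then show ?thesis using True by (simp add: pairing_def)
    next
      case False
      then have pos: "0 < Re (q 0)"
        using coeff_bound[OF q, of 0] by (smt (verit) norm_ge_zero)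
      \<comment> \<open>This is \<open>q\<close> divided by its zeroth coefficient, written with a
        dummy second summand so that the lemmas on linear combinations apply.\<close>
      define r where "r = (\<lambda>k. complex_of_real (1 / Re (q 0)) * q k + complex_of_real 0 * q k)"
      have "r 0 = complex_of_real (1 / Re (q 0)) * complex_of_real (Re (q 0))"
        by (simp add: r_def flip: zeroth_real[OF q'])
      also have "\<dots> = 1"
        using False by simp
      finally have "r 0 = 1" .
      moreover have "r \<in> closed_pos_polys \<Lambda>"
        using q pos unfolding r_def by (simp only: closed_pos_polys_iff coeffs_linear trig_poly_linear) simp
      ultimately have "pairing \<Lambda> c m \<le> pairing \<Lambda> c r"
        by (intro m(2)) (simp add: closed_pos_polys_normalized_def)
      also have "\<dots> = pairing \<Lambda> c q / Re (q 0)"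
        unfolding r_def pairing_linear by simp
      finally show ?thesis
        using pos by (simp add: field_simps)
    qed
  qed
qed

lemma divergence_lower_bound:
  assumes "(p, q) \<in> dual_feasible \<Lambda>" "0 < s"
  shows "ennreal (ln s + (1 - s) * Re (q 0)) \<le> divergence p q"
proof -
  let ?f = "\<lambda>\<theta>. trig_poly \<Lambda> p \<theta> * ln s + (1 - s) * trig_poly \<Lambda> q \<theta>"
  have int: "integrable torus_measure ?f" by auto
  have "ln s + (1 - s) * Re (q 0) = (LINT \<theta>|torus_measure. ?f \<theta>)"
    using assms by (simp add: integral_poly feasible_iff)
  also have "ennreal \<dots> \<le> (\<integral>\<^sup>+\<theta>. ennreal (?f \<theta>) \<partial>torus_measure)"
  proof -
    have "(LINT \<theta>|torus_measure. ?f \<theta>) \<le> (LINT \<theta>|torus_measure. max 0 (?f \<theta>))"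
      using int by (intro integral_mono) auto
    then have "ennreal (LINT \<theta>|torus_measure. ?f \<theta>) \<le> ennreal (LINT \<theta>|torus_measure. max 0 (?f \<theta>))"
      by (rule ennreal_leI)
    also have "\<dots> = (\<integral>\<^sup>+\<theta>. ennreal (max 0 (?f \<theta>)) \<partial>torus_measure)"
      using int by (intro nn_integral_eq_integral[symmetric]) auto
    also have "\<dots> = (\<integral>\<^sup>+\<theta>. ennreal (?f \<theta>) \<partial>torus_measure)"
      by (simp add: max_def ennreal_neg cong: if_cong) (intro nn_integral_cong, simp add: ennreal_neg)
    finally show ?thesis .
  qed
  also have "\<dots> \<le> divergence p q"
    unfolding divergence_def using assms
    by (intro nn_integral_mono kl_ge_affine) (auto simp: feasible_iff)
  finally show ?thesis .
qed

text \<open>The \<open>q 0\<close> of \<open>linear_part\<close> cancels against that of the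
  divergence bound, and only \<open>- s * Re (q 0)\<close> remains. An \<open>s\<close> below the
  coercivity constant of \<open>c\<close> then makes the bound grow with \<open>q 0\<close>.\<close>

lemma dual_objective_lower_bound:
  assumes pq: "(p, q) \<in> dual_feasible \<Lambda>" and s: "0 < s"
  shows "ereal (pairing \<Lambda> c q - pairing \<Lambda> \<gamma> p + 1 + ln s - s * Re (q 0)) \<le> dual_objective \<Lambda> c \<gamma> (p, q)"
proof -
  have "ereal (ln s + (1 - s) * Re (q 0)) \<le> enn2ereal (ennreal (ln s + (1 - s) * Re (q 0)))"
    by (simp add: ennreal.rep_eq)
  also have "\<dots> \<le> enn2ereal (divergence p q)"
    using divergence_lower_bound[OF assms] by (simp add: less_eq_ennreal.rep_eq)
  finally have "ereal (linear_part c \<gamma> p q) + ereal (ln s + (1 - s) * Re (q 0))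
      \<le> ereal (linear_part c \<gamma> p q) + enn2ereal (divergence p q)"
    by (intro add_left_mono)
  also have "ereal (linear_part c \<gamma> p q) + ereal (ln s + (1 - s) * Re (q 0))
      = ereal (pairing \<Lambda> c q - pairing \<Lambda> \<gamma> p + 1 + ln s - s * Re (q 0))"
    using pq by (simp add: linear_part_def feasible_iff algebra_simps)
  finally show ?thesis
    by (simp only: dual_objective_eq[OF pq])
qed

text \<open>The linear part converges, so the divergences converge to \<open>l\<close> minus its
  limit, and Fatou's lemma with \<open>kl_lsc\<close> bounds the divergence of the limit by that
  number. The value \<open>l\<close> may be infinite.\<close>

lemma dual_objective_lsc:
  assumes feas: "\<And>n. (p n, q n) \<in> dual_feasible \<Lambda>" and feas0: "(p0, q0) \<in> dual_feasible \<Lambda>"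
    and p: "p \<longlonglongrightarrow> p0" and q: "q \<longlonglongrightarrow> q0"
    and lim: "(\<lambda>n. dual_objective \<Lambda> c \<gamma> (p n, q n)) \<longlonglongrightarrow> l"
  shows "dual_objective \<Lambda> c \<gamma> (p0, q0) \<le> l"
proof -
  note coord = tendsto_coordinate[OF p] tendsto_coordinate[OF q]
  have tp: "(\<lambda>n. trig_poly \<Lambda> (p n) \<theta>) \<longlonglongrightarrow> trig_poly \<Lambda> p0 \<theta>"
      "(\<lambda>n. trig_poly \<Lambda> (q n) \<theta>) \<longlonglongrightarrow> trig_poly \<Lambda> q0 \<theta>" for \<theta>
    unfolding trig_poly_def by (intro tendsto_intros coord)+
  have lin: "(\<lambda>n. linear_part c \<gamma> (p n) (q n)) \<longlonglongrightarrow> linear_part c \<gamma> p0 q0"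
    unfolding linear_part_def pairing_def by (intro tendsto_intros coord)
  \<comment> \<open>Makes \<open>l\<close> minus the linear part nonnegative, so that
    \<open>e2ennreal\<close> below does not truncate it.\<close>
  have le_l: "ereal (linear_part c \<gamma> p0 q0) \<le> l"
  proof (rule LIMSEQ_le[OF _ lim])
    show "(\<lambda>n. ereal (linear_part c \<gamma> (p n) (q n))) \<longlonglongrightarrow> ereal (linear_part c \<gamma> p0 q0)"
      using lin by simp
    have "ereal (linear_part c \<gamma> (p n) (q n)) \<le> dual_objective \<Lambda> c \<gamma> (p n, q n)" for n
      by (simp add: dual_objective_eq[OF feas] add_increasing2)
    then show "\<exists>N. \<forall>n\<ge>N. ereal (linear_part c \<gamma> (p n) (q n)) \<le> dual_objective \<Lambda> c \<gamma> (p n, q n)"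
      by blast
  qed
  have "divergence p0 q0 \<le> (\<integral>\<^sup>+\<theta>. liminf (\<lambda>n. kl (trig_poly \<Lambda> (p n) \<theta>) (trig_poly \<Lambda> (q n) \<theta>)) \<partial>torus_measure)"
    unfolding divergence_def using feas
    by (intro nn_integral_mono kl_lsc tp) (auto simp: feasible_iff)
  also have "\<dots> \<le> liminf (\<lambda>n. divergence (p n) (q n))"
    unfolding divergence_def by (intro nn_integral_liminf) measurable
  also have "(\<lambda>n. divergence (p n) (q n)) \<longlonglongrightarrow> e2ennreal (l - ereal (linear_part c \<gamma> p0 q0))"
  proof -
    have "(\<lambda>n. dual_objective \<Lambda> c \<gamma> (p n, q n) - ereal (linear_part c \<gamma> (p n) (q n)))
        \<longlonglongrightarrow> l - ereal (linear_part c \<gamma> p0 q0)"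
      using lim lin by (intro tendsto_diff_ereal_general) auto
    moreover have "dual_objective \<Lambda> c \<gamma> (p n, q n) - ereal (linear_part c \<gamma> (p n) (q n))
        = enn2ereal (divergence (p n) (q n))" for n
      by (cases "divergence (p n) (q n)") (simp_all add: dual_objective_eq[OF feas] ennreal.rep_eq)
    ultimately have "(\<lambda>n. enn2ereal (divergence (p n) (q n))) \<longlonglongrightarrow> l - ereal (linear_part c \<gamma> p0 q0)"
      by simp
    from tendsto_e2ennrealI[OF this] show ?thesis
      by simp
  qed
  then have "liminf (\<lambda>n. divergence (p n) (q n)) = e2ennreal (l - ereal (linear_part c \<gamma> p0 q0))"
    by (intro lim_imp_Liminf) auto
  finally have "enn2ereal (divergence p0 q0) \<le> l - ereal (linear_part c \<gamma> p0 q0)"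
    using le_l by (simp add: less_eq_ennreal.rep_eq enn2ereal_e2ennreal ereal_diff_positive)
  then show ?thesis
    unfolding dual_objective_eq[OF feas0]
    by (cases l; cases "divergence p0 q0") (auto simp: ennreal.rep_eq)
qed

lemma dual_optimal_iff:
  "dual_optimal \<Lambda> c \<gamma> x \<longleftrightarrow> x \<in> dual_feasible \<Lambda> \<and>
     (\<forall>y\<in>dual_feasible \<Lambda>. dual_objective \<Lambda> c \<gamma> x \<le> dual_objective \<Lambda> c \<gamma> y)"
  by (auto simp: dual_optimal_def is_arg_min_def not_less)

lemma one_feasible: "(one_poly, one_poly) \<in> dual_feasible \<Lambda>"
  using one_poly_normalized by (auto simp: dual_feasible_def closed_pos_polys_normalized_def)

lemma dual_objective_one: "dual_objective \<Lambda> c \<gamma> (one_poly, one_poly) = ereal (linear_part c \<gamma> one_poly one_poly)"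
  unfolding dual_objective_eq[OF one_feasible]
  by (simp add: divergence_def trig_poly_one kl_def zero_ennreal.rep_eq)

lemma dual_optimal_exists:
  assumes "c \<in> dual_cone \<Lambda>"
  shows "\<exists>p q. dual_optimal \<Lambda> c \<gamma> (p, q)"
proof -
  let ?J = "dual_objective \<Lambda> c \<gamma>"
  obtain e where e: "0 < e" "\<And>q. q \<in> closed_pos_polys \<Lambda> \<Longrightarrow> e * Re (q 0) \<le> pairing \<Lambda> c q"
    using dual_cone_coercive[OF assms] by blast
  define v where "v = linear_part c \<gamma> one_poly one_poly"
  define G where "G = (\<Sum>k\<in>\<Lambda>. norm (\<gamma> k))"
  \<comment> \<open>With \<open>s = e / 2\<close> in the lower bound, coercivity leaves
    \<open>(e / 2) * Re (q 0)\<close>, and beyond \<open>B\<close> the bound is at least the value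
    \<open>v\<close> at (1, 1). The maximum with 1 keeps (1, 1) itself in \<open>F\<close>.\<close>
  define B where "B = max 1 ((v + G - 1 - ln (e / 2)) / (e / 2))"
  define F where "F = closed_pos_polys_normalized \<Lambda> \<times> {q \<in> closed_pos_polys \<Lambda>. Re (q 0) \<le> B}"
  have F_sub: "F \<subseteq> dual_feasible \<Lambda>"
    by (auto simp: F_def dual_feasible_def)
  have one_F: "(one_poly, one_poly) \<in> F"
    using one_feasible one_poly_normalized by (simp add: F_def dual_feasible_def) (simp add: B_def one_poly_def)
  have outside: "?J (one_poly, one_poly) \<le> ?J (p, q)" if pq: "(p, q) \<in> dual_feasible \<Lambda>" and B: "B < Re (q 0)" for p q
  proof -
    have p: "p \<in> closed_pos_polys \<Lambda>" "p 0 = 1" and q: "q \<in> closed_pos_polys \<Lambda>"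
      using pq by (auto simp: dual_feasible_def closed_pos_polys_normalized_def)
    have "\<bar>pairing \<Lambda> \<gamma> p\<bar> \<le> (\<Sum>k\<in>\<Lambda>. norm (\<gamma> k) * norm (p k))"
      by (rule abs_pairing_le)
    also have "\<dots> \<le> (\<Sum>k\<in>\<Lambda>. norm (\<gamma> k) * 1)"
      using coeff_bound[OF p(1)] p(2) by (intro sum_mono mult_left_mono) auto
    finally have G: "pairing \<Lambda> \<gamma> p \<le> G" by (simp add: G_def)
    have "(v + G - 1 - ln (e / 2)) / (e / 2) \<le> Re (q 0)"
      using B by (simp add: B_def)
    then have "v + G - 1 - ln (e / 2) \<le> (e / 2) * Re (q 0)"
      using e(1) by (simp add: field_simps)
    then have "v \<le> pairing \<Lambda> c q - pairing \<Lambda> \<gamma> p + 1 + ln (e / 2) - (e / 2) * Re (q 0)"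
      using G e(2)[OF q] by simp
    then have "ereal v \<le> ereal (pairing \<Lambda> c q - pairing \<Lambda> \<gamma> p + 1 + ln (e / 2) - (e / 2) * Re (q 0))"
      by simp
    also have "\<dots> \<le> ?J (p, q)"
      using e(1) by (intro dual_objective_lower_bound[OF pq]) auto
    finally show ?thesis
      by (simp add: dual_objective_one v_def)
  qed
  have "compact F"
    unfolding F_def by (intro compact_Times compact_closed_pos_polys_normalized compact_bounded_pos_polys)
  then have "seq_compact F"
    by (rule compact_imp_seq_compact)
  \<comment> \<open>The infimum is taken in the extended reals, so a minimizing sequence exists
    before finiteness is known.\<close>
  obtain u where u: "\<And>n. u n \<in> ?J ` F" "u \<longlonglongrightarrow> Inf (?J ` F)"
    using Inf_as_limit[of "?J ` F"] one_F by blast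
  then have "\<forall>n. \<exists>x\<in>F. u n = ?J x" by blast
  then obtain x where x: "\<And>n. x n \<in> F" "\<And>n. u n = ?J (x n)" by metis
  obtain l r where l: "l \<in> F" "strict_mono r" "(x \<circ> r) \<longlonglongrightarrow> l"
    using \<open>seq_compact F\<close> x(1) unfolding seq_compact_def by metis
  have "?J (fst l, snd l) \<le> Inf (?J ` F)"
  proof (rule dual_objective_lsc)
    show "(\<lambda>n. fst (x (r n))) \<longlonglongrightarrow> fst l" "(\<lambda>n. snd (x (r n))) \<longlonglongrightarrow> snd l"
      using tendsto_fst[OF l(3)] tendsto_snd[OF l(3)] by (simp_all add: o_def)
    have "(\<lambda>n. u (r n)) \<longlonglongrightarrow> Inf (?J ` F)"
      using LIMSEQ_subseq_LIMSEQ[OF u(2) l(2)] by (simp add: o_def)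
    then show "(\<lambda>n. ?J (fst (x (r n)), snd (x (r n)))) \<longlonglongrightarrow> Inf (?J ` F)"
      by (simp add: x(2))
  qed (use F_sub x(1) l(1) in auto)
  then have min: "?J l \<le> ?J y" if "y \<in> F" for y
    using that by (metis INF_lower order_trans prod.collapse)
  have "?J l \<le> ?J (p, q)" if pq: "(p, q) \<in> dual_feasible \<Lambda>" for p q
  proof (cases "Re (q 0) \<le> B")
    case True
    then show ?thesis
      using pq by (intro min) (auto simp: F_def dual_feasible_def)
  next
    case False
    then show ?thesis
      using min[OF one_F] outside[OF pq] by (meson not_le order_trans)
  qed
  then have "dual_optimal \<Lambda> c \<gamma> (fst l, snd l)"
    using l(1) F_sub by (auto simp: dual_optimal_iff)
  then show ?thesis by blast
qed

section \<open>Finite values of the objective, and positivity of the optimal Q in dimension at most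
  two\<close>

lemma dual_objective_real:
  assumes P: "\<And>\<theta>. 0 < trig_poly \<Lambda> p \<theta>" and Q: "AE \<theta> in torus_measure. 0 < trig_poly \<Lambda> q \<theta>"
    and int: "integrable torus_measure (\<lambda>\<theta>. trig_poly \<Lambda> p \<theta> * ln (trig_poly \<Lambda> p \<theta> / trig_poly \<Lambda> q \<theta>))"
  shows "dual_objective \<Lambda> c \<gamma> (p, q) = ereal (pairing \<Lambda> c q - pairing \<Lambda> \<gamma> p
    + (LINT \<theta>|torus_measure. trig_poly \<Lambda> p \<theta> * ln (trig_poly \<Lambda> p \<theta> / trig_poly \<Lambda> q \<theta>)))"
proof -
  have not_zero: "\<not> (\<forall>\<theta>\<in>torus. trig_poly \<Lambda> q \<theta> = 0)"
  proof
    assume *: "\<forall>\<theta>\<in>torus. trig_poly \<Lambda> q \<theta> = 0"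
    have "AE \<theta> in (torus_measure :: (real ^ 'd) measure). False"
      using Q AE_space by eventually_elim (use * in auto)
    then have "ae_filter (torus_measure :: (real ^ 'd) measure) = bot"
      by (simp add: trivial_limit_def)
    then have "emeasure (torus_measure :: (real ^ 'd) measure) torus = 0"
      by (simp add: ae_filter_eq_bot_iff)
    then show False
      by (simp add: emeasure_torus)
  qed
  \<comment> \<open>\<open>Q\<close> may have zeros here: the formula is applied to an optimal
    \<open>Q\<close> before its zeros have been excluded.\<close>
  have "AE \<theta> in torus_measure. entropy_integrand (trig_poly \<Lambda> p \<theta>) (trig_poly \<Lambda> q \<theta>)
      = ereal (trig_poly \<Lambda> p \<theta> * ln (trig_poly \<Lambda> p \<theta> / trig_poly \<Lambda> q \<theta>))"
    using Q
  proof eventually_elim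
    case (elim \<theta>)
    then show ?case
      using P[of \<theta>] by (simp add: entropy_integrand_def)
  qed
  then have "ext_integral torus_measure (\<lambda>\<theta>. entropy_integrand (trig_poly \<Lambda> p \<theta>) (trig_poly \<Lambda> q \<theta>))
      = ext_integral torus_measure (\<lambda>\<theta>. ereal (trig_poly \<Lambda> p \<theta> * ln (trig_poly \<Lambda> p \<theta> / trig_poly \<Lambda> q \<theta>)))"
    by (rule ext_integral_cong_AE)
  also have "\<dots> = ereal (LINT \<theta>|torus_measure. trig_poly \<Lambda> p \<theta> * ln (trig_poly \<Lambda> p \<theta> / trig_poly \<Lambda> q \<theta>))"
    by (rule ext_integral_ereal[OF int])
  finally show ?thesis
    by (simp only: dual_objective_def prod.case not_zero if_False plus_ereal.simps)
qed

lemma integrable_entropy: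
  assumes P: "\<And>\<theta>. 0 < trig_poly \<Lambda> p \<theta>" and Q: "\<And>\<theta>. 0 < trig_poly \<Lambda> q \<theta>"
  shows "integrable torus_measure (\<lambda>\<theta>. trig_poly \<Lambda> p \<theta> * ln (trig_poly \<Lambda> p \<theta> / trig_poly \<Lambda> q \<theta>))"
  by (intro integrable_torus_continuous continuous_intros)
    (use P Q in \<open>auto simp: less_imp_neq[symmetric] divide_pos_pos\<close>)

lemma feasibleI:
  assumes "p \<in> coeffs \<Lambda>" "\<And>\<theta>. 0 < trig_poly \<Lambda> p \<theta>" "p 0 = 1"
    and "q \<in> coeffs \<Lambda>" "\<And>\<theta>. 0 < trig_poly \<Lambda> q \<theta>"
  shows "(p, q) \<in> dual_feasible \<Lambda>"
  using assms by (simp add: feasible_iff less_imp_le)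

text \<open>The inequality log (Q / (Q + t)) \<le> - t / (Q + t) replaces a derivative at
  \<open>Q\<close>. Optimality then gives \<integral> P / (Q + t) \<le> Re c_0 for every
  \<open>t > 0\<close>, and the lower bound on \<open>P\<close> turns this into a uniform bound on
  \<integral> 1 / (Q + t).\<close>

lemma optimal_q_positive:
  assumes d: "CARD('d) \<le> 2"
    and opt: "dual_optimal \<Lambda> c \<gamma> (p, q)" and pos_p: "p \<in> pos_polys_normalized \<Lambda>"
  shows "q \<in> pos_polys \<Lambda>"
proof (rule ccontr)
  assume notpos: "q \<notin> pos_polys \<Lambda>"
  let ?M = "torus_measure :: (real ^ 'd) measure"
  let ?P = "trig_poly \<Lambda> p" and ?Q = "trig_poly \<Lambda> q"
  have feas: "(p, q) \<in> dual_feasible \<Lambda>"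
    using opt by (simp add: dual_optimal_iff)
  then have Q_nonneg: "\<And>\<theta>. 0 \<le> ?Q \<theta>" and q: "q \<in> coeffs \<Lambda>" and p: "p \<in> coeffs \<Lambda>" "p 0 = 1"
    by (auto simp: feasible_iff)
  obtain \<theta>0 where \<theta>0: "\<theta>0 \<in> torus" "?Q \<theta>0 = 0"
    using notpos q Q_nonneg by (force simp: pos_polys_def not_less intro: antisym)
  have "p \<in> pos_polys \<Lambda>"
    using pos_p by (simp add: pos_polys_normalized_def)
  then obtain e where e: "0 < e" "\<And>\<theta>. e \<le> ?P \<theta>"
    using pos_polys_lower_bound by blast
  have P_pos: "0 < ?P \<theta>" for \<theta>
    using e(1) e(2)[of \<theta>] by linarith
  \<comment> \<open>The finite value at (1, 1) makes the optimal divergence finite. Since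
    \<open>P > 0\<close> and \<open>kl\<close> is infinite at a zero of \<open>Q\<close>, the zeros
    of \<open>Q\<close> form a null set.\<close>
  have "dual_objective \<Lambda> c \<gamma> (p, q) \<le> dual_objective \<Lambda> c \<gamma> (one_poly, one_poly)"
    using opt one_feasible by (simp add: dual_optimal_iff)
  then have div_fin: "divergence p q \<noteq> \<infinity>"
    by (auto simp: dual_objective_eq[OF feas] dual_objective_one)
  then have "AE \<theta> in ?M. kl (?P \<theta>) (?Q \<theta>) \<noteq> \<infinity>"
    unfolding divergence_def by (intro nn_integral_noteq_infinite) auto
  then have Q_pos: "AE \<theta> in ?M. 0 < ?Q \<theta>"
  proof eventually_elim
    case (elim \<theta>)
    then show ?case
      using P_pos[of \<theta>] Q_nonneg[of \<theta>] by (auto simp: kl_def split: if_splits)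
  qed
  let ?f = "\<lambda>\<theta>. ?P \<theta> * ln (?P \<theta> / ?Q \<theta>)"
  have int_f: "integrable ?M ?f"
  proof -
    \<comment> \<open>Almost everywhere \<open>?g\<close> is \<open>kl\<close> as a real function; a
      finite divergence makes it integrable, and the two polynomials in it are then removed.\<close>
    let ?g = "\<lambda>\<theta>. ?f \<theta> - ?P \<theta> + ?Q \<theta>"
    have g: "AE \<theta> in ?M. 0 \<le> ?g \<theta> \<and> kl (?P \<theta>) (?Q \<theta>) = ennreal (?g \<theta>)"
      using Q_pos
    proof eventually_elim
      case (elim \<theta>)
      have "?P \<theta> * ln (?Q \<theta> / ?P \<theta>) \<le> ?P \<theta> * (?Q \<theta> / ?P \<theta> - 1)"
        using elim P_pos[of \<theta>] by (intro mult_left_mono ln_le_minus_one) auto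
      then show ?case
        using elim P_pos[of \<theta>] by (simp add: kl_def ln_div algebra_simps)
    qed
    have "integrable ?M ?g"
    proof (rule integrableI_nonneg)
      have "(\<integral>\<^sup>+\<theta>. ennreal (?g \<theta>) \<partial>?M) = divergence p q"
        unfolding divergence_def using g by (intro nn_integral_cong_AE) auto
      then show "(\<integral>\<^sup>+\<theta>. ennreal (?g \<theta>) \<partial>?M) < \<infinity>"
        using div_fin by (simp add: less_top)
    qed (use g in auto)
    from Bochner_Integration.integrable_diff[OF Bochner_Integration.integrable_add[OF this integrable_trig_poly] integrable_trig_poly]
    have "integrable ?M (\<lambda>\<theta>. ?g \<theta> + ?P \<theta> - ?Q \<theta>)" .
    moreover have "(\<lambda>\<theta>. ?g \<theta> + ?P \<theta> - ?Q \<theta>) = ?f"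
      by (rule ext) simp
    ultimately show ?thesis by (simp only:)
  qed
  \<comment> \<open>This is \<open>Re (c 0)\<close>, the slope of the pairing in the direction
    1.\<close>
  define C where "C = pairing \<Lambda> c one_poly"
  have bound: "(LINT \<theta>|?M. 1 / (?Q \<theta> + t)) \<le> C / e"
    and int_t: "integrable ?M (\<lambda>\<theta>. 1 / (?Q \<theta> + t))" if t: "0 < t" for t
  proof -
    define q' where "q' = (\<lambda>k. complex_of_real 1 * q k + complex_of_real t * one_poly k)"
    have q': "q' \<in> coeffs \<Lambda>" "\<And>\<theta>. trig_poly \<Lambda> q' \<theta> = ?Q \<theta> + t" "pairing \<Lambda> c q' = pairing \<Lambda> c q + t * C"
      unfolding q'_def C_def
      by (simp_all only: coeffs_linear q one_poly_coeffs trig_poly_linear pairing_linear trig_poly_one mult_1 mult_1_right)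
    have Qt_pos: "0 < ?Q \<theta> + t" for \<theta>
      using Q_nonneg[of \<theta>] t by linarith
    then have q'_pos: "0 < trig_poly \<Lambda> q' \<theta>" for \<theta>
      by (simp add: q')
    have Qt_ne: "?Q \<theta> + t \<noteq> 0" for \<theta>
      using Qt_pos[of \<theta>] by simp
    show int_t: "integrable ?M (\<lambda>\<theta>. 1 / (?Q \<theta> + t))"
      by (intro integrable_torus_continuous continuous_intros) (simp add: Qt_ne)
    have int_Pt: "integrable ?M (\<lambda>\<theta>. ?P \<theta> / (?Q \<theta> + t))"
      by (intro integrable_torus_continuous continuous_intros) (simp add: Qt_ne)
    let ?f' = "\<lambda>\<theta>. ?P \<theta> * ln (?P \<theta> / trig_poly \<Lambda> q' \<theta>)"
    have int_f': "integrable ?M ?f'"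
      by (intro integrable_entropy P_pos q'_pos)
    have "dual_objective \<Lambda> c \<gamma> (p, q) \<le> dual_objective \<Lambda> c \<gamma> (p, q')"
      using opt feasibleI[OF p(1) P_pos p(2) q'(1) q'_pos] by (simp add: dual_optimal_iff)
    then have "(LINT \<theta>|?M. ?f \<theta>) \<le> t * C + (LINT \<theta>|?M. ?f' \<theta>)"
      using dual_objective_real[OF P_pos Q_pos int_f, of c \<gamma>] dual_objective_real[OF P_pos _ int_f', of c \<gamma>]
      by (simp add: q'_pos q'(3))
    also have "(LINT \<theta>|?M. ?f' \<theta>) \<le> (LINT \<theta>|?M. ?f \<theta> - t * (?P \<theta> / (?Q \<theta> + t)))"
    proof (rule integral_mono_AE)
      show "AE \<theta> in ?M. ?f' \<theta> \<le> ?f \<theta> - t * (?P \<theta> / (?Q \<theta> + t))"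
        using Q_pos
      proof eventually_elim
        case (elim \<theta>)
        have "ln (?Q \<theta> / (?Q \<theta> + t)) \<le> ?Q \<theta> / (?Q \<theta> + t) - 1"
          using elim Qt_pos[of \<theta>] by (intro ln_le_minus_one) simp
        also have "\<dots> = - t / (?Q \<theta> + t)"
          using Qt_ne[of \<theta>] by (simp add: field_simps)
        finally have "?P \<theta> * ln (?Q \<theta> / (?Q \<theta> + t)) \<le> ?P \<theta> * (- t / (?Q \<theta> + t))"
          using P_pos[of \<theta>] by (intro mult_left_mono) auto
        moreover have "?f' \<theta> = ?f \<theta> + ?P \<theta> * ln (?Q \<theta> / (?Q \<theta> + t))"
          using elim P_pos[of \<theta>] Qt_pos[of \<theta>] by (simp add: q' ln_div algebra_simps)
        ultimately show ?case by (simp add: mult.commute)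
      qed
    qed (intro Bochner_Integration.integrable_diff integrable_mult_right int_f int_f' int_Pt)+
    also have "\<dots> = (LINT \<theta>|?M. ?f \<theta>) - t * (LINT \<theta>|?M. ?P \<theta> / (?Q \<theta> + t))"
      using int_f int_Pt
      by (simp only: Bochner_Integration.integral_diff integral_mult_right_zero integrable_mult_right)
    finally have "t * (LINT \<theta>|?M. ?P \<theta> / (?Q \<theta> + t)) \<le> t * C"
      by simp
    then have le: "(LINT \<theta>|?M. ?P \<theta> / (?Q \<theta> + t)) \<le> C"
      using t by simp
    have "e * (LINT \<theta>|?M. 1 / (?Q \<theta> + t)) = (LINT \<theta>|?M. e * (1 / (?Q \<theta> + t)))"
      by (simp only: integral_mult_right_zero)
    also have "\<dots> \<le> (LINT \<theta>|?M. ?P \<theta> / (?Q \<theta> + t))"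
    proof (rule integral_mono)
      show "integrable ?M (\<lambda>\<theta>. e * (1 / (?Q \<theta> + t)))"
        using int_t by (rule integrable_mult_right)
      show "e * (1 / (?Q \<theta> + t)) \<le> ?P \<theta> / (?Q \<theta> + t)" for \<theta>
        using e(2)[of \<theta>] Qt_pos[of \<theta>] by (simp add: divide_right_mono)
    qed (rule int_Pt)
    also note le
    finally show "(LINT \<theta>|?M. 1 / (?Q \<theta> + t)) \<le> C / e"
      using e(1) by (simp add: field_simps)
  qed
  define h where "h n = inverse (real (Suc n))" for n
  have h_pos: "0 < h n" for n
    by (simp add: h_def)
  have h_lim: "h \<longlonglongrightarrow> 0"
    unfolding h_def by (rule LIMSEQ_inverse_real_of_nat)
  \<comment> \<open>Fatou's lemma along \<open>t = h n\<close>; the bound \<open>C / e\<close> does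
    not depend on \<open>t\<close>.\<close>
  have "(\<integral>\<^sup>+\<theta>. ennreal (1 / ?Q \<theta>) \<partial>?M) = (\<integral>\<^sup>+\<theta>. liminf (\<lambda>n. ennreal (1 / (?Q \<theta> + h n))) \<partial>?M)"
  proof (rule nn_integral_cong_AE)
    show "AE \<theta> in ?M. ennreal (1 / ?Q \<theta>) = liminf (\<lambda>n. ennreal (1 / (?Q \<theta> + h n)))"
      using Q_pos
    proof eventually_elim
      case (elim \<theta>)
      have "(\<lambda>n. ennreal (1 / (?Q \<theta> + h n))) \<longlonglongrightarrow> ennreal (1 / (?Q \<theta> + 0))"
        using elim by (intro tendsto_ennrealI tendsto_intros h_lim) auto
      then show ?case
        by (simp add: lim_imp_Liminf)
    qed
  qed
  also have "\<dots> \<le> liminf (\<lambda>n. \<integral>\<^sup>+\<theta>. ennreal (1 / (?Q \<theta> + h n)) \<partial>?M)"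
    by (intro nn_integral_liminf) measurable
  also have "\<dots> \<le> liminf (\<lambda>n. ennreal (C / e))"
  proof (intro Liminf_mono always_eventually allI)
    fix n
    have "(\<integral>\<^sup>+\<theta>. ennreal (1 / (?Q \<theta> + h n)) \<partial>?M) = ennreal (LINT \<theta>|?M. 1 / (?Q \<theta> + h n))"
      using Q_nonneg h_pos[of n] by (intro nn_integral_eq_integral int_t) (auto simp: add_nonneg_nonneg less_imp_le)
    also have "\<dots> \<le> ennreal (C / e)"
      by (intro ennreal_leI bound h_pos)
    finally show "(\<integral>\<^sup>+\<theta>. ennreal (1 / (?Q \<theta> + h n)) \<partial>?M) \<le> ennreal (C / e)" .
  qed
  also have "\<dots> < \<infinity>"
    by (simp add: Liminf_const)
  finally have "integrable ?M (\<lambda>\<theta>. 1 / ?Q \<theta>)"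
    using Q_nonneg by (intro integrableI_nonneg) auto
  then show False
    using not_integrable_inverse_trig_poly[OF d Q_nonneg \<theta>0 Q_pos] by blast
qed

end

section \<open>Interior optima\<close>

text \<open>For small \<open>t\<close> of the sign opposite to \<open>a\<close> the linear term
  would win and make the expression negative. This stands in for setting a derivative to 0, and it
  needs \<open>t\<close> of both signs.\<close>

lemma linear_coeff_zero:
  fixes a C \<delta> :: real
  assumes "0 < \<delta>" "\<And>t. \<bar>t\<bar> \<le> \<delta> \<Longrightarrow> 0 \<le> t * a + t\<^sup>2 * C"
  shows "a = 0"
proof (rule ccontr)
  assume a: "a \<noteq> 0"
  define D where "D = \<bar>C\<bar> + 1"
  \<comment> \<open>The second bound on \<open>u\<close> makes the quadratic term at most half of
    the linear one.\<close>
  define u where "u = min \<delta> (\<bar>a\<bar> / (2 * D))"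
  have D: "0 < D" "C \<le> D" by (auto simp: D_def)
  have u: "0 < u" "u \<le> \<delta>" "u * D \<le> \<bar>a\<bar> / 2"
    using a assms(1) D by (auto simp: u_def min_def field_simps)
  have "0 \<le> (- sgn a * u) * a + (- sgn a * u)\<^sup>2 * C"
    using u by (intro assms(2)) (simp add: abs_mult abs_sgn_eq)
  also have "\<dots> = - \<bar>a\<bar> * u + u\<^sup>2 * C"
    using a by (auto simp: sgn_if abs_if)
  also have "\<dots> \<le> - \<bar>a\<bar> * u + u\<^sup>2 * D"
    using D by (intro add_left_mono mult_left_mono) auto
  also have "\<dots> = u * (u * D - \<bar>a\<bar>)"
    by (simp add: algebra_simps power2_eq_square)
  also have "\<dots> < 0"
    using u a by (intro mult_pos_neg) auto
  finally show False by simp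
qed

locale interior_optimum = symmetric_index_set \<Lambda> for \<Lambda> :: "(int ^ 'd) set" +
  fixes c \<gamma> p q :: "int ^ 'd \<Rightarrow> complex"
  assumes herm_c: "\<And>k. k \<in> \<Lambda> \<Longrightarrow> c (- k) = cnj (c k)"
    and herm_\<gamma>: "\<And>k. k \<in> \<Lambda> - {0} \<Longrightarrow> \<gamma> (- k) = cnj (\<gamma> k)"
    and optimal: "dual_optimal \<Lambda> c \<gamma> (p, q)"
    and pos_p: "p \<in> pos_polys_normalized \<Lambda>" and pos_q: "q \<in> pos_polys \<Lambda>"
begin

abbreviation "M \<equiv> torus_measure :: (real ^ 'd) measure"
abbreviation "P \<equiv> trig_poly \<Lambda> p"
abbreviation "Q \<equiv> trig_poly \<Lambda> q"
abbreviation "\<Phi> \<equiv> \<lambda>\<theta>. P \<theta> / Q \<theta>"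

lemma coeffs_p: "p \<in> coeffs \<Lambda>" and coeffs_q: "q \<in> coeffs \<Lambda>" and p_zero: "p 0 = 1"
  using pos_p pos_q by (auto simp: pos_polys_normalized_def pos_polys_def)

lemma P_pos: "0 < P \<theta>" and Q_pos: "0 < Q \<theta>"
proof -
  have "p \<in> pos_polys \<Lambda>"
    using pos_p by (simp add: pos_polys_normalized_def)
  then show "0 < P \<theta>" "0 < Q \<theta>"
    by (metis pos_polys_lower_bound order_less_le_trans, metis pos_q pos_polys_lower_bound order_less_le_trans)
qed

lemma nonzero [simp]: "P \<theta> \<noteq> 0" "Q \<theta> \<noteq> 0"
  using P_pos[of \<theta>] Q_pos[of \<theta>] by auto

lemma integrable_ratio: "integrable M \<Phi>"
  by (intro integrable_torus_continuous continuous_intros) auto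

lemma integrable_ln_ratio: "integrable M (\<lambda>\<theta>. ln (\<Phi> \<theta>))"
  by (intro integrable_torus_continuous continuous_intros) (auto simp: P_pos Q_pos)

text \<open>The first variation in the direction \<open>R\<close> is \<langle>c, r\<rangle> -
  \<integral> (P / Q) R. The remainder is controlled by |log (1 + x) - x| \<le> 2 x^2 at x = t R /
  Q.\<close>

lemma stationary_q:
  assumes r: "r \<in> coeffs \<Lambda>"
  shows "pairing \<Lambda> c r = (LINT \<theta>|M. \<Phi> \<theta> * trig_poly \<Lambda> r \<theta>)"
proof -
  let ?R = "trig_poly \<Lambda> r"
  obtain e where e: "0 < e" "\<And>\<theta>. e \<le> Q \<theta>"
    using pos_polys_lower_bound[OF pos_q] by blast
  define B where "B = (\<Sum>k\<in>\<Lambda>. norm (r k)) + 1"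
  have B: "0 < B" "\<And>\<theta>. \<bar>?R \<theta>\<bar> \<le> B"
    unfolding B_def
    by (rule add_nonneg_pos[OF sum_nonneg], simp, simp,
        rule order_trans[OF abs_trig_poly_le less_imp_le[OF less_add_one]])
  \<comment> \<open>Chosen so that |t R / Q| \<le> 1/2, the range in which the quadratic bound on
    the logarithm holds; this also keeps \<open>Q + t R\<close> positive.\<close>
  define \<delta> where "\<delta> = e / (2 * B)"
  have \<delta>: "0 < \<delta>" using e B by (simp add: \<delta>_def)
  define C where "C = (LINT \<theta>|M. 2 * P \<theta> * (?R \<theta> / Q \<theta>)\<^sup>2)"
  define D where "D = (LINT \<theta>|M. \<Phi> \<theta> * ?R \<theta>)"
  have int1: "integrable M (\<lambda>\<theta>. \<Phi> \<theta> * ?R \<theta>)"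
    and int2: "integrable M (\<lambda>\<theta>. 2 * P \<theta> * (?R \<theta> / Q \<theta>)\<^sup>2)"
    by (intro integrable_torus_continuous continuous_intros; simp)+
  have "pairing \<Lambda> c r - D = 0"
  proof (rule linear_coeff_zero[OF \<delta>])
    fix t :: real assume t: "\<bar>t\<bar> \<le> \<delta>"
    define q' where "q' = (\<lambda>k. complex_of_real 1 * q k + complex_of_real t * r k)"
    have q': "q' \<in> coeffs \<Lambda>" "\<And>\<theta>. trig_poly \<Lambda> q' \<theta> = Q \<theta> + t * ?R \<theta>"
      "pairing \<Lambda> c q' = pairing \<Lambda> c q + t * pairing \<Lambda> c r"
      unfolding q'_def by (simp_all only: coeffs_linear coeffs_q r trig_poly_linear pairing_linear mult_1)
    have x: "\<bar>t * ?R \<theta> / Q \<theta>\<bar> \<le> 1 / 2" for \<theta>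
    proof -
      have "\<bar>t * ?R \<theta>\<bar> \<le> \<delta> * B"
        using t B by (simp add: abs_mult mult_mono')
      also have "\<dots> \<le> Q \<theta> / 2"
        using e B by (simp add: \<delta>_def)
      finally show ?thesis
        using Q_pos[of \<theta>] by (simp add: abs_divide field_simps)
    qed
    have fac: "trig_poly \<Lambda> q' \<theta> = Q \<theta> * (1 + t * ?R \<theta> / Q \<theta>)" for \<theta>
      by (simp add: q' field_simps)
    have one_pos: "0 < 1 + t * ?R \<theta> / Q \<theta>" for \<theta>
      using x[of \<theta>] unfolding abs_le_iff by linarith
    have q'_pos: "0 < trig_poly \<Lambda> q' \<theta>" for \<theta>
      unfolding fac by (intro mult_pos_pos Q_pos one_pos)
    let ?f = "\<lambda>\<theta>. P \<theta> * ln (P \<theta> / Q \<theta>)" and ?f' = "\<lambda>\<theta>. P \<theta> * ln (P \<theta> / trig_poly \<Lambda> q' \<theta>)"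
    have intf: "integrable M ?f" "integrable M ?f'"
      by (intro integrable_entropy P_pos Q_pos q'_pos)+
    have "dual_objective \<Lambda> c \<gamma> (p, q) \<le> dual_objective \<Lambda> c \<gamma> (p, q')"
      using optimal feasibleI[OF coeffs_p P_pos p_zero q'(1) q'_pos] by (simp add: dual_optimal_iff)
    then have "(LINT \<theta>|M. ?f \<theta>) \<le> t * pairing \<Lambda> c r + (LINT \<theta>|M. ?f' \<theta>)"
      using dual_objective_real[OF P_pos _ intf(1), of c \<gamma>] dual_objective_real[OF P_pos _ intf(2), of c \<gamma>]
      by (simp add: Q_pos q'_pos q'(3))
    also have "(LINT \<theta>|M. ?f' \<theta>) \<le> (LINT \<theta>|M. ?f \<theta> - t * (\<Phi> \<theta> * ?R \<theta>) + t\<^sup>2 * (2 * P \<theta> * (?R \<theta> / Q \<theta>)\<^sup>2))"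
    proof (rule integral_mono)
      fix \<theta>
      define X where "X = t * ?R \<theta> / Q \<theta>"
      have X: "\<bar>X\<bar> \<le> 1 / 2" "0 < 1 + X" "trig_poly \<Lambda> q' \<theta> = Q \<theta> * (1 + X)"
        using x[of \<theta>] one_pos[of \<theta>] fac[of \<theta>] by (simp_all only: X_def)
      have "- ln (1 + X) \<le> - X + 2 * X\<^sup>2"
        using abs_ln_one_plus_x_minus_x_bound[OF X(1)] by linarith
      then have "P \<theta> * (- ln (1 + X)) \<le> P \<theta> * (- X + 2 * X\<^sup>2)"
        using P_pos[of \<theta>] by (intro mult_left_mono) auto
      moreover have "ln (P \<theta> / trig_poly \<Lambda> q' \<theta>) = ln (P \<theta> / Q \<theta>) - ln (1 + X)"
        using P_pos[of \<theta>] Q_pos[of \<theta>] X by (simp add: ln_divide_pos ln_mult_pos)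
      then have "?f' \<theta> = ?f \<theta> + P \<theta> * (- ln (1 + X))"
        by (simp add: right_diff_distrib)
      moreover have "P \<theta> * (- X + 2 * X\<^sup>2) = - t * (\<Phi> \<theta> * ?R \<theta>) + t\<^sup>2 * (2 * P \<theta> * (?R \<theta> / Q \<theta>)\<^sup>2)"
        by (simp add: X_def power2_eq_square algebra_simps)
      ultimately show "?f' \<theta> \<le> ?f \<theta> - t * (\<Phi> \<theta> * ?R \<theta>) + t\<^sup>2 * (2 * P \<theta> * (?R \<theta> / Q \<theta>)\<^sup>2)"
        by linarith
    qed (intro intf Bochner_Integration.integrable_add Bochner_Integration.integrable_diff
        integrable_mult_right int1 int2)+
    also have "\<dots> = (LINT \<theta>|M. ?f \<theta>) - t * D + t\<^sup>2 * C"
      using intf int1 int2 by (simp only: C_def D_def Bochner_Integration.integral_add Bochner_Integration.integral_diff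
        integral_mult_right_zero Bochner_Integration.integrable_diff Bochner_Integration.integrable_add integrable_mult_right)
    finally show "0 \<le> t * (pairing \<Lambda> c r - D) + t\<^sup>2 * C"
      by (simp add: algebra_simps)
  qed
  then show ?thesis by (simp add: D_def)
qed

text \<open>The condition \<open>r 0 = 0\<close> preserves the normalization of \<open>P\<close> and
  also removes the term \<integral> R, which arises because x log x has derivative log x +
  1.\<close>

lemma stationary_p:
  assumes r: "r \<in> coeffs \<Lambda>" and r0: "r 0 = 0"
  shows "pairing \<Lambda> \<gamma> r = (LINT \<theta>|M. ln (\<Phi> \<theta>) * trig_poly \<Lambda> r \<theta>)"
proof -
  let ?R = "trig_poly \<Lambda> r"
  have "p \<in> pos_polys \<Lambda>"
    using pos_p by (simp add: pos_polys_normalized_def)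
  then obtain e where e: "0 < e" "\<And>\<theta>. e \<le> P \<theta>"
    using pos_polys_lower_bound by blast
  define B where "B = (\<Sum>k\<in>\<Lambda>. norm (r k)) + 1"
  have B: "0 < B" "\<And>\<theta>. \<bar>?R \<theta>\<bar> \<le> B"
    unfolding B_def
    by (rule add_nonneg_pos[OF sum_nonneg], simp, simp,
        rule order_trans[OF abs_trig_poly_le less_imp_le[OF less_add_one]])
  define \<delta> where "\<delta> = e / (2 * B)"
  have \<delta>: "0 < \<delta>" using e B by (simp add: \<delta>_def)
  define C where "C = (LINT \<theta>|M. (?R \<theta>)\<^sup>2 / P \<theta>)"
  define D where "D = (LINT \<theta>|M. ln (\<Phi> \<theta>) * ?R \<theta>)"
  have int1: "integrable M (\<lambda>\<theta>. ln (\<Phi> \<theta>) * ?R \<theta>)"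
    by (intro integrable_trig_poly_mult integrable_ln_ratio)
  have int2: "integrable M (\<lambda>\<theta>. (?R \<theta>)\<^sup>2 / P \<theta>)"
    by (intro integrable_torus_continuous continuous_intros; simp)
  have R_int: "(LINT \<theta>|M. ?R \<theta>) = 0"
    using integral_poly[OF r] r0 by simp
  have "D - pairing \<Lambda> \<gamma> r = 0"
  proof (rule linear_coeff_zero[OF \<delta>])
    fix t :: real assume t: "\<bar>t\<bar> \<le> \<delta>"
    define p' where "p' = (\<lambda>k. complex_of_real 1 * p k + complex_of_real t * r k)"
    have p': "p' \<in> coeffs \<Lambda>" "\<And>\<theta>. trig_poly \<Lambda> p' \<theta> = P \<theta> + t * ?R \<theta>"
      "pairing \<Lambda> \<gamma> p' = pairing \<Lambda> \<gamma> p + t * pairing \<Lambda> \<gamma> r"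
      unfolding p'_def by (simp_all only: coeffs_linear coeffs_p r trig_poly_linear pairing_linear mult_1)
    have p'0: "p' 0 = 1"
      by (simp add: p'_def p_zero r0)
    have p'_pos: "0 < trig_poly \<Lambda> p' \<theta>" for \<theta>
    proof -
      have "\<bar>t * ?R \<theta>\<bar> \<le> \<delta> * B"
        using t B by (simp add: abs_mult mult_mono')
      also have "\<dots> < P \<theta>"
        using e(1) e(2)[of \<theta>] B by (simp add: \<delta>_def)
      finally show ?thesis
        by (simp add: p')
    qed
    let ?f = "\<lambda>\<theta>. P \<theta> * ln (P \<theta> / Q \<theta>)" and ?f' = "\<lambda>\<theta>. trig_poly \<Lambda> p' \<theta> * ln (trig_poly \<Lambda> p' \<theta> / Q \<theta>)"
    have intf: "integrable M ?f" "integrable M ?f'"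
      by (intro integrable_entropy P_pos Q_pos p'_pos)+
    have "dual_objective \<Lambda> c \<gamma> (p, q) \<le> dual_objective \<Lambda> c \<gamma> (p', q)"
      using optimal feasibleI[OF p'(1) p'_pos p'0 coeffs_q Q_pos] by (simp add: dual_optimal_iff)
    then have "(LINT \<theta>|M. ?f \<theta>) \<le> - t * pairing \<Lambda> \<gamma> r + (LINT \<theta>|M. ?f' \<theta>)"
      using dual_objective_real[OF P_pos _ intf(1), of c \<gamma>] dual_objective_real[OF p'_pos _ intf(2), of c \<gamma>]
      by (simp add: Q_pos p'(3))
    also have "(LINT \<theta>|M. ?f' \<theta>) \<le> (LINT \<theta>|M. ?f \<theta> + t * (ln (\<Phi> \<theta>) * ?R \<theta>) + t * ?R \<theta> + t\<^sup>2 * ((?R \<theta>)\<^sup>2 / P \<theta>))"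
    proof (rule integral_mono)
      fix \<theta>
      \<comment> \<open>Here log x \<le> x - 1 already suffices: multiplied by
        \<open>P + t R\<close> it produces the quadratic remainder t^2 R^2 / P.\<close>
      have "ln (trig_poly \<Lambda> p' \<theta> / P \<theta>) \<le> trig_poly \<Lambda> p' \<theta> / P \<theta> - 1"
        using P_pos[of \<theta>] p'_pos[of \<theta>] by (intro ln_le_minus_one) simp
      also have "\<dots> = t * ?R \<theta> / P \<theta>"
        by (simp add: p' field_simps)
      finally have "trig_poly \<Lambda> p' \<theta> * ln (trig_poly \<Lambda> p' \<theta> / P \<theta>) \<le> (P \<theta> + t * ?R \<theta>) * (t * ?R \<theta> / P \<theta>)"
        unfolding p'(2)[symmetric] using p'_pos[of \<theta>] by (intro mult_left_mono) auto
      also have "\<dots> = t * ?R \<theta> + t\<^sup>2 * ((?R \<theta>)\<^sup>2 / P \<theta>)"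
        by (simp add: field_simps power2_eq_square)
      finally have *: "trig_poly \<Lambda> p' \<theta> * ln (trig_poly \<Lambda> p' \<theta> / P \<theta>) \<le> t * ?R \<theta> + t\<^sup>2 * ((?R \<theta>)\<^sup>2 / P \<theta>)" .
      have "ln (trig_poly \<Lambda> p' \<theta> / Q \<theta>) = ln (\<Phi> \<theta>) + ln (trig_poly \<Lambda> p' \<theta> / P \<theta>)"
        using P_pos[of \<theta>] Q_pos[of \<theta>] p'_pos[of \<theta>] by (simp add: ln_div)
      then have "?f' \<theta> = (P \<theta> + t * ?R \<theta>) * ln (\<Phi> \<theta>) + trig_poly \<Lambda> p' \<theta> * ln (trig_poly \<Lambda> p' \<theta> / P \<theta>)"
        by (simp only: distrib_left p'(2)[symmetric])
      with * show "?f' \<theta> \<le> ?f \<theta> + t * (ln (\<Phi> \<theta>) * ?R \<theta>) + t * ?R \<theta> + t\<^sup>2 * ((?R \<theta>)\<^sup>2 / P \<theta>)"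
        by (simp add: algebra_simps)
    qed (intro intf Bochner_Integration.integrable_add integrable_mult_right integrable_trig_poly int1 int2)+
    also have "\<dots> = (LINT \<theta>|M. ?f \<theta>) + t * D + t * (LINT \<theta>|M. ?R \<theta>) + t\<^sup>2 * C"
      using intf int1 int2 by (simp only: C_def D_def Bochner_Integration.integral_add
        integral_mult_right_zero Bochner_Integration.integrable_add integrable_mult_right integrable_trig_poly)
    finally show "0 \<le> t * (D - pairing \<Lambda> \<gamma> r) + t\<^sup>2 * C"
      by (simp add: R_int algebra_simps)
  qed
  then show ?thesis by (simp add: D_def)
qed

section \<open>Moment conditions and primal optimality\<close>

lemma moments:
  assumes "k \<in> \<Lambda>"
  shows "c k = (LINT \<theta>|M. character k \<theta> * complex_of_real (\<Phi> \<theta>))"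
proof (rule eq_of_pairing_eq[OF fin, where S=\<Lambda> and b="\<lambda>k. LINT \<theta>|M. character k \<theta> * complex_of_real (\<Phi> \<theta>)"])
  show "- k \<in> \<Lambda>" if "k \<in> \<Lambda>" for k
    using sym that by blast
  show "pairing \<Lambda> c r = pairing \<Lambda> (\<lambda>k. LINT \<theta>|M. character k \<theta> * complex_of_real (\<Phi> \<theta>)) r" if "r \<in> coeffs \<Lambda>" for r
    by (simp only: stationary_q[OF that] pairing_moments[OF fin integrable_ratio])
qed (erule herm_c | rule moments_hermitian order_refl assms)+

text \<open>Only directions with \<open>r 0 = 0\<close> are admissible for \<open>P\<close>, so the
  separation argument runs on \<Lambda> without 0 and gives no information about the zeroth
  logarithmic moment.\<close>

lemma log_moments:
  assumes "k \<in> \<Lambda> - {0}"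
  shows "has_log_moment \<Phi> k (\<gamma> k)"
proof -
  have "\<gamma> k = (LINT \<theta>|M. character k \<theta> * complex_of_real (ln (\<Phi> \<theta>)))"
  proof (rule eq_of_pairing_eq[OF fin, where S="\<Lambda> - {0}" and b="\<lambda>k. LINT \<theta>|M. character k \<theta> * complex_of_real (ln (\<Phi> \<theta>))"])
    show "- k \<in> \<Lambda> - {0}" if "k \<in> \<Lambda> - {0}" for k
      using sym that by auto
    show "pairing \<Lambda> \<gamma> r = pairing \<Lambda> (\<lambda>k. LINT \<theta>|M. character k \<theta> * complex_of_real (ln (\<Phi> \<theta>))) r"
      if "r \<in> coeffs \<Lambda>" "\<And>k. k \<notin> \<Lambda> - {0} \<Longrightarrow> r k = 0" for r
    proof -
      have "r 0 = 0" using that(2) by simp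
      then show ?thesis
        by (simp only: stationary_p[OF that(1)] pairing_moments[OF fin integrable_ln_ratio])
    qed
  qed (erule herm_\<gamma> | rule moments_hermitian Diff_subset assms)+
  then show ?thesis
    by (simp add: has_log_moment_def integrable_ln_ratio P_pos Q_pos)
qed

lemma ratio_feasible: "\<Phi> \<in> primal_feasible \<Lambda> c \<gamma>"
  unfolding primal_feasible_def
  using log_moments moments integrable_ratio by (auto simp: P_pos Q_pos less_imp_le)

lemma measure_moments:
  assumes "k \<in> \<Lambda>"
  shows "c k = (LINT \<theta>|density M (\<lambda>\<theta>. ennreal (\<Phi> \<theta>)). character k \<theta>)"
proof -
  have "(LINT \<theta>|density M (\<lambda>\<theta>. ennreal (\<Phi> \<theta>)). character k \<theta>) = (LINT \<theta>|M. \<Phi> \<theta> *\<^sub>R character k \<theta>)"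
    by (rule integral_density) (auto simp: P_pos Q_pos less_imp_le)
  then show ?thesis
    by (simp only: moments[OF assms] scaleR_conv_of_real mult.commute)
qed

text \<open>Any two feasible functions have the same logarithmic moments off 0, so that
  \<open>\<integral> log \<Psi> - \<integral> log \<Phi> = \<integral> P log (\<Psi> / \<Phi>) \<le> \<integral> (Q \<Psi> - P) = 0\<close>.\<close>

lemma primal_bound:
  assumes feas: "\<Psi> \<in> primal_feasible \<Lambda> c \<gamma>"
    and pos: "AE \<theta> in M. 0 < \<Psi> \<theta>" and int: "integrable M (\<lambda>\<theta>. ln (\<Psi> \<theta>))"
  shows "(LINT \<theta>|M. ln (\<Psi> \<theta>)) \<le> (LINT \<theta>|M. ln (\<Phi> \<theta>))"
proof -
  have int\<Psi>: "integrable M \<Psi>"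
    using feas by (simp add: primal_feasible_def)
  \<comment> \<open>Since \<open>p 0 = 1\<close>, weighting with \<open>P\<close> contributes
    \<integral> log F itself plus a sum of prescribed moments, which is the same for every feasible
    \<open>F\<close>.\<close>
  have weighted: "(LINT \<theta>|M. ln (F \<theta>) * P \<theta>) = (LINT \<theta>|M. ln (F \<theta>)) + (\<Sum>k\<in>\<Lambda> - {0}. Re (\<gamma> k * cnj (p k)))"
    if F: "F \<in> primal_feasible \<Lambda> c \<gamma>" "integrable M (\<lambda>\<theta>. ln (F \<theta>))" for F
  proof -
    let ?m = "\<lambda>k. LINT \<theta>|M. character k \<theta> * complex_of_real (ln (F \<theta>))"
    have "(LINT \<theta>|M. ln (F \<theta>) * P \<theta>) = (\<Sum>k\<in>\<Lambda>. Re (?m k * cnj (p k)))"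
      using pairing_moments[OF fin F(2), of p] by (simp add: pairing_def)
    also have "\<dots> = Re (?m 0 * cnj (p 0)) + (\<Sum>k\<in>\<Lambda> - {0}. Re (?m k * cnj (p k)))"
      by (rule sum.remove[OF fin zero])
    also have "(\<Sum>k\<in>\<Lambda> - {0}. Re (?m k * cnj (p k))) = (\<Sum>k\<in>\<Lambda> - {0}. Re (\<gamma> k * cnj (p k)))"
      using F(1) by (intro sum.cong refl) (simp add: primal_feasible_def has_log_moment_def)
    finally show ?thesis
      by (simp add: p_zero)
  qed
  \<comment> \<open>The integral against \<open>Q\<close> depends only on the prescribed moments
    \<open>c\<close>, so the right-hand side of the comparison below cancels.\<close>
  have c_int: "(LINT \<theta>|M. F \<theta> * Q \<theta>) = pairing \<Lambda> c q" if F: "F \<in> primal_feasible \<Lambda> c \<gamma>" for F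
  proof -
    have "(LINT \<theta>|M. F \<theta> * Q \<theta>) = pairing \<Lambda> (\<lambda>k. LINT \<theta>|M. character k \<theta> * complex_of_real (F \<theta>)) q"
      using F by (intro pairing_moments[OF fin, symmetric]) (simp add: primal_feasible_def)
    also have "\<dots> = pairing \<Lambda> c q"
      unfolding pairing_def using F by (intro arg_cong[where f=Re] sum.cong refl) (simp add: primal_feasible_def)
    finally show ?thesis .
  qed
  have "(LINT \<theta>|M. ln (\<Psi> \<theta>)) - (LINT \<theta>|M. ln (\<Phi> \<theta>))
      = (LINT \<theta>|M. ln (\<Psi> \<theta>) * P \<theta>) - (LINT \<theta>|M. ln (\<Phi> \<theta>) * P \<theta>)"
    by (simp only: weighted[OF feas int] weighted[OF ratio_feasible integrable_ln_ratio])
  also have "\<dots> = (LINT \<theta>|M. ln (\<Psi> \<theta>) * P \<theta> - ln (\<Phi> \<theta>) * P \<theta>)"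
    by (intro Bochner_Integration.integral_diff[symmetric] integrable_trig_poly_mult int integrable_ln_ratio)
  also have "\<dots> \<le> (LINT \<theta>|M. \<Psi> \<theta> * Q \<theta> - \<Phi> \<theta> * Q \<theta>)"
  proof (rule integral_mono_AE)
    show "AE \<theta> in M. ln (\<Psi> \<theta>) * P \<theta> - ln (\<Phi> \<theta>) * P \<theta> \<le> \<Psi> \<theta> * Q \<theta> - \<Phi> \<theta> * Q \<theta>"
      using pos
    proof eventually_elim
      case (elim \<theta>)
      have \<Phi>: "0 < \<Phi> \<theta>"
        using P_pos[of \<theta>] Q_pos[of \<theta>] by simp
      \<comment> \<open>The tangent inequality for log at the ratio \<Psi> / \<Phi>; since P =
        \<Phi> Q, the weight \<open>P\<close> clears the denominator.\<close>
      have "ln (\<Psi> \<theta>) - ln (\<Phi> \<theta>) = ln (\<Psi> \<theta> / \<Phi> \<theta>)"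
        by (rule ln_divide_pos[OF elim \<Phi>, symmetric])
      also have "\<dots> \<le> \<Psi> \<theta> / \<Phi> \<theta> - 1"
        by (rule ln_le_minus_one[OF divide_pos_pos[OF elim \<Phi>]])
      finally have "(ln (\<Psi> \<theta>) - ln (\<Phi> \<theta>)) * P \<theta> \<le> (\<Psi> \<theta> / \<Phi> \<theta> - 1) * P \<theta>"
        using P_pos[of \<theta>] by (intro mult_right_mono) auto
      also have "\<dots> = \<Psi> \<theta> * Q \<theta> - \<Phi> \<theta> * Q \<theta>"
        by (simp add: field_simps)
      finally show ?case
        by (simp only: left_diff_distrib)
    qed
  qed (intro Bochner_Integration.integrable_diff integrable_trig_poly_mult int integrable_ln_ratio int\<Psi> integrable_ratio)+
  also have "\<dots> = (LINT \<theta>|M. \<Psi> \<theta> * Q \<theta>) - (LINT \<theta>|M. \<Phi> \<theta> * Q \<theta>)"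
    by (intro Bochner_Integration.integral_diff integrable_trig_poly_mult int\<Psi> integrable_ratio)
  also have "\<dots> = 0"
    by (simp only: c_int[OF feas] c_int[OF ratio_feasible])
  finally show ?thesis by simp
qed

lemma primal_optimal_ratio: "primal_optimal \<Lambda> c \<gamma> \<Phi>"
proof -
  have "primal_objective \<Psi> \<le> primal_objective \<Phi>" if feas: "\<Psi> \<in> primal_feasible \<Lambda> c \<gamma>" for \<Psi>
  proof (cases "(AE \<theta> in M. 0 < \<Psi> \<theta>) \<and> integrable M (\<lambda>\<theta>. ln (\<Psi> \<theta>))")
    case True
    have "primal_objective \<Phi> = ereal (LINT \<theta>|M. ln (\<Phi> \<theta>))"
      by (rule primal_objective_eq[OF _ integrable_ln_ratio]) (simp add: P_pos Q_pos)
    with True show ?thesis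
      using primal_bound[OF feas] by (simp add: primal_objective_eq)
  next
    \<comment> \<open>By \<open>has_log_moment\<close> this can happen only if \<Lambda> has no
      nonzero index.\<close>
    case False
    then show ?thesis
      using feas by (subst primal_objective_minus_infinity) (auto simp: primal_feasible_def)
  qed
  then show ?thesis
    using ratio_feasible by (auto simp: primal_optimal_def is_arg_max_def not_less)
qed

end

theorem theorem2p4:
  fixes \<Lambda> :: "(int ^ 'd) set"
    and c \<gamma> :: "int ^ 'd \<Rightarrow> complex"
  assumes "finite \<Lambda>" and "0 \<in> \<Lambda>" and "uminus ` \<Lambda> = \<Lambda>"
    and "\<forall>k\<in>\<Lambda> - {0}. \<gamma> (- k) = cnj (\<gamma> k)" and "\<gamma> 0 = 1"
    and "c \<in> dual_cone \<Lambda>"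
  shows "convex_problem (dual_objective \<Lambda> c \<gamma>) (dual_feasible \<Lambda>) \<and>
    (\<exists>P Q. dual_optimal \<Lambda> c \<gamma> (P, Q)) \<and>
    (\<forall>P Q. dual_optimal \<Lambda> c \<gamma> (P, Q) \<longrightarrow>
       (P, Q) \<in> pos_polys_normalized \<Lambda> \<times> pos_polys \<Lambda> \<longrightarrow>
       (let \<Phi> = (\<lambda>\<theta>. trig_poly \<Lambda> P \<theta> / trig_poly \<Lambda> Q \<theta>);
            \<mu> = density torus_measure (\<lambda>\<theta>. ennreal (\<Phi> \<theta>))
        in (\<forall>k\<in>\<Lambda> - {0}. has_log_moment \<Phi> k (\<gamma> k)) \<and>
           (\<forall>k\<in>\<Lambda>. c k = (LINT \<theta>|\<mu>. character k \<theta>)) \<and>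
           primal_optimal \<Lambda> c \<gamma> \<Phi>)) \<and>
    (CARD('d) \<le> 2 \<longrightarrow>
       (\<forall>P Q. dual_optimal \<Lambda> c \<gamma> (P, Q) \<longrightarrow>
          P \<in> pos_polys_normalized \<Lambda> \<longrightarrow> Q \<in> pos_polys \<Lambda>))"
proof -
  interpret symmetric_index_set \<Lambda>
    using assms by unfold_locales
  have interior: "(\<forall>k\<in>\<Lambda> - {0}. has_log_moment (\<lambda>\<theta>. trig_poly \<Lambda> P \<theta> / trig_poly \<Lambda> Q \<theta>) k (\<gamma> k)) \<and>
      (\<forall>k\<in>\<Lambda>. c k = (LINT \<theta>|density torus_measure (\<lambda>\<theta>. ennreal (trig_poly \<Lambda> P \<theta> / trig_poly \<Lambda> Q \<theta>)). character k \<theta>)) \<and>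
      primal_optimal \<Lambda> c \<gamma> (\<lambda>\<theta>. trig_poly \<Lambda> P \<theta> / trig_poly \<Lambda> Q \<theta>)"
    if "dual_optimal \<Lambda> c \<gamma> (P, Q)" "(P, Q) \<in> pos_polys_normalized \<Lambda> \<times> pos_polys \<Lambda>" for P Q
  proof -
    interpret interior_optimum \<Lambda> c \<gamma> P Q
      using assms that by unfold_locales (auto simp: dual_cone_def coeffs_def)
    show ?thesis
      using log_moments measure_moments primal_optimal_ratio by blast
  qed
  show ?thesis
    unfolding Let_def
    by (rule conjI[OF convex_problem_dual conjI[OF dual_optimal_exists[OF assms(6)] conjI]])
      (intro allI impI, erule (1) interior, intro allI impI, erule (2) optimal_q_positive)
qed

end
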